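(* Let $q$ be a prime power and $n\ge2$ with $\gcd(q,n)=1$, and use the notation of the context. Let $C\subset\mathbb{F}_qD_n$ be a dihedral code such that $$\mathcal{P}(C)=\bigoplus_{j=1}^{r+s}B_j,\qquad B_j=\begin{cases}A_j,&j\in K_1\\ I_j(0,1),&j\in K_2\\ I_j(1,0),&j\in K_3\\ 0,&j\notin K_1\cup K_2\cup K_3,\end{cases}$$ where $K_1\subset\{1,\dots,r+s\}$ and $K_2,K_3\subset\{r+1,\dots,r+s\}$ are pairwise disjoint sets. Let $$g(x)=\left(\prod_{j\in K_1\cup K_2}f_j(x)\right)\left(\prod_{\substack{r+1\le j\le r+s\\ j\in K_1\cup K_3}}f_j^*(x)\right).$$ Then $C=(\mathbb{F}_qD_n)f(a)$, where $f(x)=(x^n-1)/g(x)$.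
   Context: $D_n=\langle a,b\mid a^n=1,\ b^2=1,\ bab=a^{-1}\rangle$ is the dihedral group of order $2n$, $\mathbb{F}_qD_n$ its group algebra; every element is uniquely $P(a)+bQ(a)$ with $P,Q\in\mathbb{F}_q[x]$ of degree less than $n$. A dihedral code is a left ideal of $\mathbb{F}_qD_n$. For $g\in\mathbb{F}_q[x]$ with $g(0)\neq0$ put $g^*(x)=x^{\deg g}g(x^{-1})$. Factor $x^n-1$ over $\mathbb{F}_q$ into (pairwise distinct) monic irreducible factors as $x^n-1=(f_1f_2\cdots f_r)(f_{r+1}f_{r+1}^*\cdots f_{r+s}f_{r+s}^* )$, where $f_1=x-1$, $f_2=x+1$ if $n$ is even, $f_j^*=f_j$ for $1<j\le r$, and for $j>r$ the polynomials $f_j$ and $f_j^*$ have different roots (here the factor $f_j^*$, $j>r$, is normalized by a scalar to be monic). Let $\alpha_j$ be a root of $f_j$. Let $\zeta(n)=1$ if $n$ is odd, $\zeta(n)=2$ if $n$ is even. $\langle h\mid h^2\rangle$ is the cyclic group of order 2 generated by $h$. Put $F_j=\mathbb{F}_q$ for $1\le j\le\zeta(n)$, $F_j=\mathbb{F}_q[\alpha_j+\alpha_j^{-1}]$ for $\zeta(n)+1\le j\le r$, $F_j=\mathbb{F}_q[\alpha_j]$ for $r+1\le j\le r+s$. Put $A_j=\mathbb{F}_q\langle h\mid h^2\rangle$ for $1\le j\le\zeta(n)$ and $A_j=\mathrm{M}_2(F_j)$ for $\zeta(n)+1\le j\le r+s$. Define for $u=P(a)+bQ(a)$: $\gamma_1(u)=P(1)+Q(1)h$;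 $\gamma_2(u)=P(-1)+Q(-1)h$ (for $n$ even); for $j\ge\zeta(n)+1$, $\tau_j(u)=\begin{pmatrix}P(\alpha_j)&Q(\alpha_j^{-1})\\ Q(\alpha_j)&P(\alpha_j^{-1})\end{pmatrix}$; for $\zeta(n)+1\le j\le r$, $\sigma_j(X)=Z_j^{-1}XZ_j$ with $Z_j=\begin{pmatrix}1&-\alpha_j\\ 1&-\alpha_j^{-1}\end{pmatrix}$. Put $\mathcal{P}_j=\gamma_j$ for $j\le\zeta(n)$, $\mathcal{P}_j=\sigma_j\tau_j$ for $\zeta(n)+1\le j\le r$, $\mathcal{P}_j=\tau_j$ for $r+1\le j\le r+s$. It is known that $\mathcal{P}=\bigoplus_{j=1}^{r+s}\mathcal{P}_j:\mathbb{F}_qD_n\to\bigoplus_{j=1}^{r+s}A_j$ is an algebra isomorphism. For $x,y\in F_j$ and $r+1\le j\le r+s$ put $I_j(x,y)=\left\{\begin{pmatrix}ky & -kx \\ ty & -tx\end{pmatrix}\mid k,t\in F_j\right\}$. *)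

theory Defs
  imports
    "HOL-Analysis.Analysis"
    "HOL-Algebra.Elementary_Groups"
    "HOL-Algebra.Algebraic_Closure_Type"
begin

section \<open>The dihedral group\<close>

text \<open>
  The pair \<open>(e, i)\<close> stands for \<open>b\<^sup>e a\<^sup>i\<close>, where the Boolean \<open>e\<close> is read as an exponent
  modulo 2. The product comes from the rule \<open>a\<^sup>i b = b a\<^sup>-\<^sup>i\<close>. The lemmas below show that for
  \<open>n > 0\<close> this is the group presented by \<open>\<langle>a, b | a\<^sup>n = 1, b\<^sup>2 = 1, b a b = a\<^sup>-\<^sup>1\<rangle>\<close>.
\<close>

definition dihedral_group :: "nat \<Rightarrow> (bool \<times> nat) monoid" where
  "dihedral_group n =
     \<lparr>carrier = UNIV \<times> {..<n},
      monoid.mult = (\<lambda>(e, i) (e', j). (e \<noteq> e', ((if e' then n - i else i) + j) mod n)),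
      one = (False, 0)\<rparr>"

definition dih_a :: "nat \<Rightarrow> bool \<times> nat" where
  "dih_a n = (False, 1 mod n)"

definition dih_b :: "bool \<times> nat" where
  "dih_b = (True, 0)"

lemma dihedral_inv_ex:
  assumes "i < n"
  shows "\<exists>y \<in> UNIV \<times> {..<n}. y \<otimes>\<^bsub>dihedral_group n\<^esub> (e, i) = (False, 0)"
proof (cases e)
  case True
  then show ?thesis using assms
    by (intro bexI[of _ "(True, i)"]) (auto simp: dihedral_group_def)
next
  case False
  then show ?thesis using assms
    by (intro bexI[of _ "(False, (n - i) mod n)"]) (auto simp: dihedral_group_def mod_simps)
qed

lemma group_dihedral_group:
  assumes "n > 0"
  shows "group (dihedral_group n)"
proof (rule groupI)
  fix x y assume "x \<in> carrier (dihedral_group n)" "y \<in> carrier (dihedral_group n)"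
  then show "x \<otimes>\<^bsub>dihedral_group n\<^esub> y \<in> carrier (dihedral_group n)"
    using assms by (auto simp: dihedral_group_def split: prod.splits)
next
  fix x y z
  assume xyz: "x \<in> carrier (dihedral_group n)" "y \<in> carrier (dihedral_group n)"
    "z \<in> carrier (dihedral_group n)"
  obtain e i e' j e'' k where eq: "x = (e, i)" "y = (e', j)" "z = (e'', k)"
    by (metis surj_pair)
  have bounds: "i < n" "j < n" "k < n"
    using xyz by (auto simp: dihedral_group_def eq)
  have key: "(n - (u mod n) + k) mod n = (v + k) mod n"
    if "(u + v) mod n = 0" for u v
  proof -
    have "int (u mod n) = int u - int n * int (u div n)"
      by (metis add_diff_cancel_left' of_nat_add of_nat_mult mult_div_mod_eq)
    moreover have "u mod n \<le> n" using assms by simp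
    ultimately have "int (n - u mod n + k) - int (v + k)
        = int n * (1 + int (u div n)) - int (u + v)"
      by (simp add: of_nat_diff algebra_simps)
    moreover have "int n dvd int (u + v)"
      using that by (simp only: int_dvd_int_iff mod_eq_0_iff_dvd)
    ultimately have "int n dvd int (n - u mod n + k) - int (v + k)"
      by (metis dvd_diff dvd_triv_left)
    then have "int ((n - u mod n + k) mod n) = int ((v + k) mod n)"
      by (simp only: zmod_int mod_eq_dvd_iff)
    then show ?thesis by (simp only: of_nat_eq_iff)
  qed
  have c1: "(n - ((i + j) mod n) + k) mod n = ((n - i) + (n - j) + k) mod n"
    using bounds by (intro key) (auto simp: mod_eq_0_iff_dvd)
  have c2: "(n - ((n - i + j) mod n) + k) mod n = (i + (n - j) + k) mod n"
    using bounds by (intro key) auto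
  show "x \<otimes>\<^bsub>dihedral_group n\<^esub> y \<otimes>\<^bsub>dihedral_group n\<^esub> z =
        x \<otimes>\<^bsub>dihedral_group n\<^esub> (y \<otimes>\<^bsub>dihedral_group n\<^esub> z)"
    using c1 c2 by (auto simp: dihedral_group_def eq mod_simps add.assoc)
next
  show "\<one>\<^bsub>dihedral_group n\<^esub> \<in> carrier (dihedral_group n)"
    using assms by (simp add: dihedral_group_def)
next
  fix x assume "x \<in> carrier (dihedral_group n)"
  then show "\<one>\<^bsub>dihedral_group n\<^esub> \<otimes>\<^bsub>dihedral_group n\<^esub> x = x"
    by (auto simp: dihedral_group_def)
next
  fix x assume "x \<in> carrier (dihedral_group n)"
  then show "\<exists>y\<in>carrier (dihedral_group n). y \<otimes>\<^bsub>dihedral_group n\<^esub> x = \<one>\<^bsub>dihedral_group n\<^esub>"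
    using dihedral_inv_ex[of "snd x" n "fst x"] by (auto simp: dihedral_group_def)
qed

lemma order_dihedral_group: "order (dihedral_group n) = 2 * n"
  by (simp add: order_def dihedral_group_def card_UNIV_bool card_cartesian_product)

lemma dih_a_pow:
  assumes "n > 0"
  shows "dih_a n [^]\<^bsub>dihedral_group n\<^esub> (i::nat) = (False, i mod n)"
  by (induction i) (simp_all add: nat_pow_def dih_a_def dihedral_group_def mod_simps)

lemma dih_b_mult: "dih_b \<otimes>\<^bsub>dihedral_group n\<^esub> (False, i) = (True, i mod n)"
  by (simp add: dih_b_def dihedral_group_def)

lemma dihedral_relations:
  assumes "n > 0"
  shows "dih_a n [^]\<^bsub>dihedral_group n\<^esub> n = \<one>\<^bsub>dihedral_group n\<^esub>"
    and "dih_b [^]\<^bsub>dihedral_group n\<^esub> (2::nat) = \<one>\<^bsub>dihedral_group n\<^esub>"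
    and "dih_b \<otimes>\<^bsub>dihedral_group n\<^esub> dih_a n \<otimes>\<^bsub>dihedral_group n\<^esub> dih_b
           = inv\<^bsub>dihedral_group n\<^esub> (dih_a n)"
proof -
  show "dih_a n [^]\<^bsub>dihedral_group n\<^esub> n = \<one>\<^bsub>dihedral_group n\<^esub>"
    by (simp add: dih_a_pow[OF assms]) (simp add: dihedral_group_def)
  show "dih_b [^]\<^bsub>dihedral_group n\<^esub> (2::nat) = \<one>\<^bsub>dihedral_group n\<^esub>"
    by (simp add: numeral_2_eq_2 nat_pow_def dih_b_def dihedral_group_def)
  interpret group "dihedral_group n" by (rule group_dihedral_group[OF assms])
  have "n = 1 \<or> n > 1" using assms by auto
  then show "dih_b \<otimes>\<^bsub>dihedral_group n\<^esub> dih_a n \<otimes>\<^bsub>dihedral_group n\<^esub> dih_b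
           = inv\<^bsub>dihedral_group n\<^esub> (dih_a n)"
    by (intro inv_equality[symmetric])
       (auto simp: dih_a_def dih_b_def dihedral_group_def)
qed

lemma dihedral_presentation:
  assumes "n > 0" "group H" "x \<in> carrier H" "y \<in> carrier H"
    "x [^]\<^bsub>H\<^esub> n = \<one>\<^bsub>H\<^esub>" "y [^]\<^bsub>H\<^esub> (2::nat) = \<one>\<^bsub>H\<^esub>"
    "y \<otimes>\<^bsub>H\<^esub> x \<otimes>\<^bsub>H\<^esub> y = inv\<^bsub>H\<^esub> x"
  shows "\<exists>h \<in> hom (dihedral_group n) H. h (dih_a n) = x \<and> h dih_b = y"
proof -
  interpret H: group H by fact
  note [simp] = assms(3,4)
  have yy: "y \<otimes>\<^bsub>H\<^esub> y = \<one>\<^bsub>H\<^esub>"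
    using assms(6) by (simp add: numeral_2_eq_2)
  have powmod: "x [^]\<^bsub>H\<^esub> (i mod n) = x [^]\<^bsub>H\<^esub> i" for i :: nat
  proof -
    have "x [^]\<^bsub>H\<^esub> i = x [^]\<^bsub>H\<^esub> (n * (i div n) + i mod n)" by simp
    also have "\<dots> = x [^]\<^bsub>H\<^esub> (i mod n)"
      by (simp only: H.nat_pow_mult[symmetric] assms(3) H.nat_pow_pow[symmetric] assms(5)
           H.nat_pow_one H.l_one H.nat_pow_closed)
    finally show ?thesis by simp
  qed
  have xy: "x \<otimes>\<^bsub>H\<^esub> y = y \<otimes>\<^bsub>H\<^esub> inv\<^bsub>H\<^esub> x"
    by (metis assms(3,4,7) H.m_assoc H.m_closed H.l_one yy)
  have swap: "x [^]\<^bsub>H\<^esub> i \<otimes>\<^bsub>H\<^esub> y = y \<otimes>\<^bsub>H\<^esub> inv\<^bsub>H\<^esub> (x [^]\<^bsub>H\<^esub> i)" for i :: nat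
  proof (induction i)
    case (Suc i)
    have "x [^]\<^bsub>H\<^esub> Suc i \<otimes>\<^bsub>H\<^esub> y = x [^]\<^bsub>H\<^esub> i \<otimes>\<^bsub>H\<^esub> y \<otimes>\<^bsub>H\<^esub> inv\<^bsub>H\<^esub> x"
      by (simp add: H.m_assoc xy)
    also have "\<dots> = y \<otimes>\<^bsub>H\<^esub> inv\<^bsub>H\<^esub> (x \<otimes>\<^bsub>H\<^esub> x [^]\<^bsub>H\<^esub> i)"
      by (simp add: Suc H.m_assoc H.inv_mult_group)
    also have "x \<otimes>\<^bsub>H\<^esub> x [^]\<^bsub>H\<^esub> i = x [^]\<^bsub>H\<^esub> Suc i"
      by (simp add: H.nat_pow_comm H.nat_pow_Suc2[symmetric])
    finally show ?case .
  qed simp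
  have swap': "x [^]\<^bsub>H\<^esub> i \<otimes>\<^bsub>H\<^esub> y = y \<otimes>\<^bsub>H\<^esub> x [^]\<^bsub>H\<^esub> (n - i)" if "i < n" for i :: nat
  proof -
    have "x [^]\<^bsub>H\<^esub> (n - i) \<otimes>\<^bsub>H\<^esub> x [^]\<^bsub>H\<^esub> i = \<one>\<^bsub>H\<^esub>"
      using that assms(5) by (simp add: H.nat_pow_mult)
    then have "inv\<^bsub>H\<^esub> (x [^]\<^bsub>H\<^esub> i) = x [^]\<^bsub>H\<^esub> (n - i)"
      by (intro H.inv_equality) auto
    then show ?thesis using swap by simp
  qed
  define h where "h = (\<lambda>(e, i). (if e then y else \<one>\<^bsub>H\<^esub>) \<otimes>\<^bsub>H\<^esub> x [^]\<^bsub>H\<^esub> (i::nat))"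
  have pull: "x [^]\<^bsub>H\<^esub> i \<otimes>\<^bsub>H\<^esub> (y \<otimes>\<^bsub>H\<^esub> z) = y \<otimes>\<^bsub>H\<^esub> (x [^]\<^bsub>H\<^esub> (n - i) \<otimes>\<^bsub>H\<^esub> z)"
    if "i < n" "z \<in> carrier H" for i :: nat and z
    using swap'[OF that(1)] that(2) by (metis H.m_assoc H.nat_pow_closed assms(3,4))
  have yyz: "y \<otimes>\<^bsub>H\<^esub> (y \<otimes>\<^bsub>H\<^esub> z) = z" if "z \<in> carrier H" for z
    using that yy by (metis H.m_assoc H.l_one assms(4))
  have "h \<in> hom (dihedral_group n) H"
    by (rule homI)
       (auto simp: h_def dihedral_group_def powmod H.m_assoc pull yyz H.nat_pow_mult[symmetric])
  moreover have "h (dih_a n) = x"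
    using powmod[of 1] by (simp add: h_def dih_a_def)
  moreover have "h dih_b = y"
    by (simp add: h_def dih_b_def)
  ultimately show ?thesis by blast
qed


lemma generate_dihedral_group:
  assumes "n > 0"
  shows "generate (dihedral_group n) {dih_a n, dih_b} = carrier (dihedral_group n)"
proof
  interpret group "dihedral_group n" by (rule group_dihedral_group[OF assms])
  have car: "dih_a n \<in> carrier (dihedral_group n)" "dih_b \<in> carrier (dihedral_group n)"
    using assms by (auto simp: dih_a_def dih_b_def dihedral_group_def)
  then show "generate (dihedral_group n) {dih_a n, dih_b} \<subseteq> carrier (dihedral_group n)"
    by (intro generate_incl) auto
  interpret S: subgroup "generate (dihedral_group n) {dih_a n, dih_b}" "dihedral_group n"
    using car by (intro generate_is_subgroup) auto
  have a: "dih_a n \<in> generate (dihedral_group n) {dih_a n, dih_b}"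
    and b: "dih_b \<in> generate (dihedral_group n) {dih_a n, dih_b}"
    by (auto intro: generate.incl)
  have pow: "dih_a n [^]\<^bsub>dihedral_group n\<^esub> (i::nat) \<in> generate (dihedral_group n) {dih_a n, dih_b}"
    for i by (induction i) (auto intro: a S.m_closed)
  show "carrier (dihedral_group n) \<subseteq> generate (dihedral_group n) {dih_a n, dih_b}"
  proof
    fix x assume "x \<in> carrier (dihedral_group n)"
    then obtain e i where x: "x = (e, i)" "i < n" by (auto simp: dihedral_group_def)
    show "x \<in> generate (dihedral_group n) {dih_a n, dih_b}"
      using pow[of i] S.m_closed[OF b pow[of i]] x
      by (cases e) (simp_all add: dih_a_pow[OF assms] dih_b_mult)
  qed
qed


section \<open>Group algebras of finite groups\<close>

text \<open>Only meaningful for finite \<open>G\<close>: no finiteness of supports is required.\<close>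

definition group_algebra :: "('g, 'm) monoid_scheme \<Rightarrow> ('g \<Rightarrow> 'k::field) ring" where
  "group_algebra G =
     \<lparr>carrier = {u. \<forall>x. x \<notin> carrier G \<longrightarrow> u x = 0},
      monoid.mult = (\<lambda>u v x. if x \<in> carrier G
                       then \<Sum>y\<in>carrier G. u y * v (inv\<^bsub>G\<^esub> y \<otimes>\<^bsub>G\<^esub> x) else 0),
      one = (\<lambda>x. if x = \<one>\<^bsub>G\<^esub> then 1 else 0),
      ring.zero = (\<lambda>_. 0),
      add = (\<lambda>u v x. u x + v x)\<rparr>"

text \<open>The element \<open>c \<cdot> x\<close> of the group algebra.\<close>

definition ga_single :: "'k::field \<Rightarrow> 'g \<Rightarrow> 'g \<Rightarrow> 'k" where
  "ga_single c x = (\<lambda>y. if y = x then c else 0)"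

text \<open>The value \<open>p(x)\<close> of a polynomial at a group element \<open>x\<close>, as an element of the group algebra.\<close>

definition ga_eval :: "('g, 'm) monoid_scheme \<Rightarrow> 'k::field poly \<Rightarrow> 'g \<Rightarrow> 'g \<Rightarrow> 'k" where
  "ga_eval G p x = (\<lambda>y. \<Sum>i\<le>Polynomial.degree p. ga_single (poly.coeff p i) (x [^]\<^bsub>G\<^esub> i) y)"

definition left_ideal :: "'r set \<Rightarrow> ('r, 'm) ring_scheme \<Rightarrow> bool" where
  "left_ideal I R \<longleftrightarrow> additive_subgroup I R \<and> (\<forall>u\<in>carrier R. \<forall>x\<in>I. u \<otimes>\<^bsub>R\<^esub> x \<in> I)"

definition principal_left_ideal :: "('r, 'm) ring_scheme \<Rightarrow> 'r \<Rightarrow> 'r set" where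
  "principal_left_ideal R x = {u \<otimes>\<^bsub>R\<^esub> x | u. u \<in> carrier R}"

abbreviation dihedral_algebra :: "nat \<Rightarrow> (bool \<times> nat \<Rightarrow> 'k::field) ring" where
  "dihedral_algebra n \<equiv> group_algebra (dihedral_group n)"

definition dihedral_code :: "nat \<Rightarrow> (bool \<times> nat \<Rightarrow> 'k::field) set \<Rightarrow> bool" where
  "dihedral_code n C \<longleftrightarrow> left_ideal C (dihedral_algebra n)"

definition P_part :: "nat \<Rightarrow> (bool \<times> nat \<Rightarrow> 'k::field) \<Rightarrow> 'k poly" where
  "P_part n u = (\<Sum>i<n. Polynomial.monom (u (dih_a n [^]\<^bsub>dihedral_group n\<^esub> i)) i)"

definition Q_part :: "nat \<Rightarrow> (bool \<times> nat \<Rightarrow> 'k::field) \<Rightarrow> 'k poly" where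
  "Q_part n u = (\<Sum>i<n. Polynomial.monom
     (u (dih_b \<otimes>\<^bsub>dihedral_group n\<^esub> dih_a n [^]\<^bsub>dihedral_group n\<^esub> i)) i)"


lemma poly_coeff_sum_monom:
  "poly.coeff (\<Sum>i<n. Polynomial.monom (c i) i) k = (if k < n then c k else 0)"
  by (simp add: coeff_sum if_distrib[of "\<lambda>x. x = _"] coeff_monom)

lemma ga_eval_dih_a:
  assumes "n > 0" "Polynomial.degree p < n"
  shows "ga_eval (dihedral_group n) p (dih_a n) =
           (\<lambda>(e, i). if \<not> e \<and> i < n then poly.coeff p i else 0)"
proof (intro ext, clarsimp split del: if_split)
  fix e i
  have "ga_eval (dihedral_group n) p (dih_a n) (e, i) =
      (\<Sum>k\<le>Polynomial.degree p. if k = i \<and> \<not> e then poly.coeff p k else 0)"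
    unfolding ga_eval_def ga_single_def
    using assms by (intro sum.cong) (auto simp: dih_a_pow)
  also have "\<dots> = (if \<not> e \<and> i < n then poly.coeff p i else 0)"
    using assms by (auto simp: coeff_eq_0)
  finally show "ga_eval (dihedral_group n) p (dih_a n) (e, i) =
      (if \<not> e \<and> i < n then poly.coeff p i else 0)" .
qed

lemma ga_b_mult_eval_dih_a:
  assumes "n > 0" "Polynomial.degree p < n"
  shows "ga_single 1 dih_b \<otimes>\<^bsub>dihedral_algebra n\<^esub> ga_eval (dihedral_group n) p (dih_a n) =
           (\<lambda>(e, i). if e \<and> i < n then poly.coeff p i else 0)"
proof (intro ext, clarsimp split del: if_split)
  fix e i
  interpret group "dihedral_group n" by (rule group_dihedral_group[OF assms(1)])
  have b: "dih_b \<in> carrier (dihedral_group n)"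
    using assms by (auto simp: dih_b_def dihedral_group_def)
  have inv: "inv\<^bsub>dihedral_group n\<^esub> dih_b = dih_b"
    by (rule inv_equality) (use b in \<open>auto simp: dih_b_def dihedral_group_def\<close>)
  have fin: "finite (carrier (dihedral_group n))" by (simp add: dihedral_group_def)
  show "(ga_single 1 dih_b \<otimes>\<^bsub>dihedral_algebra n\<^esub> ga_eval (dihedral_group n) p (dih_a n)) (e, i) =
      (if e \<and> i < n then poly.coeff p i else 0)"
    unfolding ga_eval_dih_a[OF assms] using b inv fin
    by (simp add: group_algebra_def ga_single_def if_distrib[of "\<lambda>x. x * _"] sum.delta cong: if_cong)
       (auto simp: dih_b_def dihedral_group_def)
qed

lemma dihedral_algebra_decomposition:
  fixes u :: "bool \<times> nat \<Rightarrow> 'k::field"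
  assumes "n > 0" "u \<in> carrier (dihedral_algebra n)"
  shows "Polynomial.degree (P_part n u) < n" "Polynomial.degree (Q_part n u) < n"
    and "u = ga_eval (dihedral_group n) (P_part n u) (dih_a n) \<oplus>\<^bsub>dihedral_algebra n\<^esub>
             ga_single 1 dih_b \<otimes>\<^bsub>dihedral_algebra n\<^esub>
             ga_eval (dihedral_group n) (Q_part n u) (dih_a n)"
proof -
  have c: "poly.coeff (P_part n u) i = (if i < n then u (False, i) else 0)"
    "poly.coeff (Q_part n u) i = (if i < n then u (True, i) else 0)" for i
    using assms(1)
    by (auto simp: P_part_def Q_part_def poly_coeff_sum_monom dih_a_pow dih_b_mult)
  have "Polynomial.degree (P_part n u) \<le> n - 1" "Polynomial.degree (Q_part n u) \<le> n - 1"
    by (auto intro!: degree_le simp: c)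
  then show d: "Polynomial.degree (P_part n u) < n" "Polynomial.degree (Q_part n u) < n"
    using assms(1) by auto
  show "u = ga_eval (dihedral_group n) (P_part n u) (dih_a n) \<oplus>\<^bsub>dihedral_algebra n\<^esub>
             ga_single 1 dih_b \<otimes>\<^bsub>dihedral_algebra n\<^esub>
             ga_eval (dihedral_group n) (Q_part n u) (dih_a n)"
    unfolding ga_b_mult_eval_dih_a[OF assms(1) d(2)] ga_eval_dih_a[OF assms(1) d(1)]
    using assms(2) by (auto simp: group_algebra_def dihedral_group_def c fun_eq_iff)
qed

lemma dihedral_algebra_decomposition_unique:
  fixes p p' :: "'k::field poly"
  assumes "n > 0" "Polynomial.degree p < n" "Polynomial.degree p' < n"
  defines "u \<equiv> ga_eval (dihedral_group n) p (dih_a n) \<oplus>\<^bsub>dihedral_algebra n\<^esub>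
             ga_single 1 dih_b \<otimes>\<^bsub>dihedral_algebra n\<^esub> ga_eval (dihedral_group n) p' (dih_a n)"
  shows "P_part n u = p" "Q_part n u = p'"
  unfolding u_def ga_b_mult_eval_dih_a[OF assms(1,3)] ga_eval_dih_a[OF assms(1,2)]
  using assms(1-3)
  by (auto intro!: poly_eqI simp: P_part_def Q_part_def poly_coeff_sum_monom dih_a_pow
      dih_b_mult group_algebra_def coeff_eq_0)


section \<open>The factorization of \<open>x\<^sup>n - 1\<close>\<close>

definition zeta :: "nat \<Rightarrow> nat" where
  "zeta n = (if even n then 2 else 1)"

text \<open>The reciprocal polynomial \<open>g\<^sup>*\<close> is the library function \<open>reflect_poly\<close>; this is its monic scalar multiple.\<close>

definition monic_reciprocal :: "'k::field poly \<Rightarrow> 'k poly" where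
  "monic_reciprocal g = Polynomial.smult (inverse (Polynomial.lead_coeff (reflect_poly g))) (reflect_poly g)"

abbreviation ac_poly :: "'k::field poly \<Rightarrow> 'k alg_closure poly" where
  "ac_poly p \<equiv> map_poly to_ac p"

definition xn_factorization :: "nat \<Rightarrow> nat \<Rightarrow> nat \<Rightarrow> (nat \<Rightarrow> 'k::field poly) \<Rightarrow> bool" where
  "xn_factorization n r s f \<longleftrightarrow>
     Polynomial.monom 1 n - 1 =
       (\<Prod>j\<in>{1..r}. f j) * (\<Prod>j\<in>{r+1..r+s}. f j * monic_reciprocal (f j)) \<and>
     (\<forall>j\<in>{1..r+s}. Factorial_Ring.irreducible (f j) \<and> Polynomial.lead_coeff (f j) = 1) \<and>
     inj_on f {1..r+s} \<and>
     inj_on (\<lambda>j. monic_reciprocal (f j)) {r+1..r+s} \<and>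
     f ` {1..r+s} \<inter> (\<lambda>j. monic_reciprocal (f j)) ` {r+1..r+s} = {} \<and>
     zeta n \<le> r \<and>
     f 1 = [:-1, 1:] \<and>
     (even n \<longrightarrow> f 2 = [:1, 1:]) \<and>
     (\<forall>j. 1 < j \<and> j \<le> r \<longrightarrow> reflect_poly (f j) = f j) \<and>
     (\<forall>j\<in>{r+1..r+s}. {\<beta>. poly (ac_poly (f j)) \<beta> = 0} \<inter>
                       {\<beta>. poly (ac_poly (monic_reciprocal (f j))) \<beta> = 0} = {})"


section \<open>The decomposition of the dihedral group algebra\<close>

text \<open>\<open>\<F>\<^sub>q[\<beta>]\<close> inside the algebraic closure.\<close>

definition adjoin :: "'k::field alg_closure \<Rightarrow> 'k alg_closure set" where
  "adjoin \<beta> = range (\<lambda>p. poly (ac_poly p) \<beta>)"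

definition comp_field :: "nat \<Rightarrow> nat \<Rightarrow> (nat \<Rightarrow> 'k::field alg_closure) \<Rightarrow> nat \<Rightarrow> 'k alg_closure set" where
  "comp_field n r \<alpha> j =
     (if j \<le> zeta n then range to_ac
      else if j \<le> r then adjoin (\<alpha> j + inverse (\<alpha> j))
      else adjoin (\<alpha> j))"

text \<open>
  A common type for the elements of the algebras \<open>A\<^sub>j\<close>, which are either the group algebra of the
  cyclic group of order 2 (realized as the integers modulo 2, with \<open>h = 1\<close>) or a matrix algebra.
  Elements of the direct sum are then extensional functions on \<open>{1..r+s}\<close>.
\<close>

type_synonym 'k component = "(int \<Rightarrow> 'k) + ('k alg_closure)^2^2"

abbreviation C2_algebra :: "(int \<Rightarrow> 'k::field) ring" where
  "C2_algebra \<equiv> group_algebra (integer_mod_group 2)"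

definition mat2 :: "'a \<Rightarrow> 'a \<Rightarrow> 'a \<Rightarrow> 'a \<Rightarrow> ('a::zero)^2^2" where
  "mat2 a b c d = vector [vector [a, b], vector [c, d]]"

definition matrices_over :: "'a set \<Rightarrow> ('a^2^2) set" where
  "matrices_over K = {M. \<forall>i l. M $ i $ l \<in> K}"

definition comp_algebra ::
  "nat \<Rightarrow> nat \<Rightarrow> (nat \<Rightarrow> 'k::field alg_closure) \<Rightarrow> nat \<Rightarrow> 'k component set" where
  "comp_algebra n r \<alpha> j =
     (if j \<le> zeta n then Inl ` carrier C2_algebra
      else Inr ` matrices_over (comp_field n r \<alpha> j))"

definition comp_zero :: "nat \<Rightarrow> nat \<Rightarrow> 'k::field component" where
  "comp_zero n j = (if j \<le> zeta n then Inl \<zero>\<^bsub>C2_algebra\<^esub> else Inr 0)"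

text \<open>With \<open>z = 1\<close> and \<open>z = -1\<close> this gives \<open>\<gamma>\<^sub>1\<close> and \<open>\<gamma>\<^sub>2\<close>.\<close>

definition gamma_map :: "nat \<Rightarrow> 'k::field \<Rightarrow> (bool \<times> nat \<Rightarrow> 'k) \<Rightarrow> int \<Rightarrow> 'k" where
  "gamma_map n z u =
     ga_single (poly (P_part n u) z) 0 \<oplus>\<^bsub>C2_algebra\<^esub> ga_single (poly (Q_part n u) z) 1"

definition tau_map :: "nat \<Rightarrow> 'k::field alg_closure \<Rightarrow> (bool \<times> nat \<Rightarrow> 'k) \<Rightarrow> ('k alg_closure)^2^2" where
  "tau_map n \<beta> u =
     mat2 (poly (ac_poly (P_part n u)) \<beta>) (poly (ac_poly (Q_part n u)) (inverse \<beta>))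
          (poly (ac_poly (Q_part n u)) \<beta>) (poly (ac_poly (P_part n u)) (inverse \<beta>))"

definition Z_mat :: "'k::field alg_closure \<Rightarrow> ('k alg_closure)^2^2" where
  "Z_mat \<beta> = mat2 1 (- \<beta>) 1 (- inverse \<beta>)"

definition sigma_map :: "'k::field alg_closure \<Rightarrow> ('k alg_closure)^2^2 \<Rightarrow> ('k alg_closure)^2^2" where
  "sigma_map \<beta> M = matrix_inv (Z_mat \<beta>) ** M ** Z_mat \<beta>"

definition comp_map ::
  "nat \<Rightarrow> nat \<Rightarrow> (nat \<Rightarrow> 'k::field alg_closure) \<Rightarrow> nat \<Rightarrow> (bool \<times> nat \<Rightarrow> 'k) \<Rightarrow> 'k component" where
  "comp_map n r \<alpha> j u =
     (if j = 1 then Inl (gamma_map n 1 u)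
      else if j \<le> zeta n then Inl (gamma_map n (- 1) u)
      else if j \<le> r then Inr (sigma_map (\<alpha> j) (tau_map n (\<alpha> j) u))
      else Inr (tau_map n (\<alpha> j) u))"

definition decomp_map ::
  "nat \<Rightarrow> nat \<Rightarrow> nat \<Rightarrow> (nat \<Rightarrow> 'k::field alg_closure) \<Rightarrow> (bool \<times> nat \<Rightarrow> 'k) \<Rightarrow> nat \<Rightarrow> 'k component" where
  "decomp_map n r s \<alpha> u = (\<lambda>j\<in>{1..r+s}. comp_map n r \<alpha> j u)"

text \<open>The left ideal \<open>I\<^sub>j(x, y)\<close>, with \<open>K = F\<^sub>j\<close>.\<close>

definition I_ideal :: "'a::comm_ring_1 set \<Rightarrow> 'a \<Rightarrow> 'a \<Rightarrow> ('a^2^2) set" where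
  "I_ideal K x y = {mat2 (k * y) (- (k * x)) (t * y) (- (t * x)) | k t. k \<in> K \<and> t \<in> K}"

end

theory Submission
  imports Defs
begin

text \<open>
  Write \<open>u = P(a) + b Q(a)\<close> and \<open>F = (x\<^sup>n - 1) / g\<close>. Both sides of the claim are the set of all \<open>u\<close>
  for which \<open>F\<close> divides \<open>P\<close> and \<open>Q\<close>.

  For the principal left ideal this holds because \<open>(P(a) + b Q(a)) F(a) = (P F)(a) + b (Q F)(a)\<close>, where
  reduction modulo \<open>x\<^sup>n - 1\<close> is harmless since \<open>F\<close> divides \<open>x\<^sup>n - 1\<close> (\<open>principal_left_ideal_ga_eval\<close>).

  For the code, each condition \<open>\<P>\<^sub>j(u) \<in> B\<^sub>j\<close> says that \<open>P\<close> and \<open>Q\<close> vanish at some of the points \<open>\<alpha>\<^sub>j\<close> and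
  \<open>\<alpha>\<^sub>j\<^sup>-\<^sup>1\<close>, that is, that they are divisible by \<open>f\<^sub>j\<close> or \<open>f\<^sub>j\<^sup>*\<close> or both. The full algebra imposes nothing, the
  ideal \<open>I\<^sub>j(0, 1)\<close> asks for divisibility by \<open>f\<^sub>j\<^sup>*\<close>, the ideal \<open>I\<^sub>j(1, 0)\<close> for divisibility by \<open>f\<^sub>j\<close>
  (\<open>comp_map_in_I_ideal\<close>), and the zero component for all that the index \<open>j\<close> offers (\<open>comp_map_eq_iff\<close>).
  The factors asked for are exactly those missing from \<open>g\<close>, and as \<open>x\<^sup>n - 1\<close> is a product of distinct
  monic irreducible polynomials, being divisible by all of them amounts to being divisible by their
  product \<open>F\<close> (\<open>prod_xn_factors_dvd_iff\<close>).

  To pass from the image of the code back to the code, one needs injectivity of the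
  decomposition, which is again \<open>comp_map_eq_iff\<close>, and the fact that every component really lands in
  \<open>A\<^sub>j\<close> (\<open>comp_map_in_comp_algebra\<close>). The latter is a computation for the self-reciprocal factors, where
  the entries of the conjugated matrix must lie in the field generated by \<open>\<alpha>\<^sub>j + \<alpha>\<^sub>j\<^sup>-\<^sup>1\<close>
  (\<open>sigma_tau_in_matrices_over\<close>).
\<close>

section \<open>Irreducible polynomials and their roots\<close>

lemma ac_poly_pCons [simp]: "ac_poly (pCons a p) = pCons (to_ac a) (ac_poly p)"
  by (simp add: map_poly_pCons)

lemma ac_poly_add [simp]: "ac_poly (p + q) = ac_poly p + ac_poly q"
  by (rule poly_eqI) (simp add: coeff_map_poly)

lemma ac_poly_diff [simp]: "ac_poly (p - q) = ac_poly p - ac_poly q"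
  by (rule poly_eqI) (simp add: coeff_map_poly)

lemma ac_poly_smult [simp]:
  "ac_poly (Polynomial.smult c p) = Polynomial.smult (to_ac c) (ac_poly p)"
  by (rule poly_eqI) (simp add: coeff_map_poly)

lemma ac_poly_mult [simp]: "ac_poly (p * q) = ac_poly p * ac_poly q"
  by (induction p) (simp_all add: mult_pCons_left)

lemma ac_poly_monom [simp]: "ac_poly (Polynomial.monom c k) = Polynomial.monom (to_ac c) k"
  by (simp add: map_poly_monom)

lemma ac_poly_reflect: "ac_poly (reflect_poly p) = reflect_poly (ac_poly p)"
  by (rule poly_eqI) (simp add: coeff_map_poly coeff_reflect_poly degree_map_poly)

lemma ac_poly_dvd_root:
  "h dvd p \<Longrightarrow> poly (ac_poly h) \<beta> = 0 \<Longrightarrow> poly (ac_poly p) \<beta> = 0"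
  by (auto elim!: dvdE)

text \<open>
  Both \<open>h\<close> and any \<open>p\<close> with root \<open>\<beta>\<close> are multiples of a polynomial \<open>m\<close> of least degree with
  that root; \<open>h\<close> being irreducible, it is associated to \<open>m\<close>.
\<close>

lemma irreducible_dvd_iff_root:
  fixes h p :: "'k::field poly"
  assumes irr: "Factorial_Ring.irreducible h" and root: "poly (ac_poly h) \<beta> = 0"
  shows "h dvd p \<longleftrightarrow> poly (ac_poly p) \<beta> = 0"
proof
  show "h dvd p \<Longrightarrow> poly (ac_poly p) \<beta> = 0"
    using root by (rule ac_poly_dvd_root[rotated])
next
  assume p: "poly (ac_poly p) \<beta> = 0"
  define V where "V = {w. w \<noteq> 0 \<and> poly (ac_poly w) \<beta> = 0}"
  define m where "m = arg_min Polynomial.degree (\<lambda>w. w \<in> V)"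
  have "h \<in> V" using irr root by (auto simp: V_def)
  then have m: "m \<in> V" "\<And>w. w \<in> V \<Longrightarrow> Polynomial.degree m \<le> Polynomial.degree w"
    unfolding m_def by (auto intro: arg_min_natI arg_min_nat_le)
  have m_dvd: "m dvd w" if "poly (ac_poly w) \<beta> = 0" for w
  proof -
    have "w mod m = w - m * (w div m)" by (simp add: minus_mult_div_eq_mod)
    then have "poly (ac_poly (w mod m)) \<beta> = 0"
      using that m(1) by (simp add: V_def)
    then have "w mod m = 0"
      using m degree_mod_less[of m w] by (force simp: V_def)
    then show ?thesis by auto
  qed
  have "\<not> m dvd 1"
    using m(1) ac_poly_dvd_root[of m 1 \<beta>] by (auto simp: V_def)
  then have "h dvd m"
    using irr m_dvd[OF root] irreducibleD' by blast
  then show "h dvd p" using m_dvd[OF p] dvd_trans by blast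
qed

text \<open>
  Reflection is multiplicative and, on polynomials with nonzero constant coefficient, an
  involution that keeps the degree, so it turns factorizations into factorizations.
\<close>

lemma irreducible_reflect_poly_field:
  fixes h :: "'k::field poly"
  assumes irr: "Factorial_Ring.irreducible h" and h0: "poly.coeff h 0 \<noteq> 0"
  shows "Factorial_Ring.irreducible (reflect_poly h)"
proof (rule Factorial_Ring.irreducibleI)
  have "h \<noteq> 0" "\<not> h dvd 1" using irr by (auto dest: irreducible_not_unit)
  then show "reflect_poly h \<noteq> 0" "\<not> reflect_poly h dvd 1"
    using h0 by (simp_all add: is_unit_iff_degree)
next
  fix a b assume ab: "reflect_poly h = a * b"
  have "poly.coeff (a * b) 0 \<noteq> 0" using irr by (auto simp flip: ab)
  then have nz: "poly.coeff a 0 \<noteq> 0" "poly.coeff b 0 \<noteq> 0" by (auto simp: coeff_mult_0)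
  have "h = reflect_poly a * reflect_poly b"
    using h0 by (metis ab reflect_poly_mult reflect_poly_reflect_poly)
  then have "reflect_poly a dvd 1 \<or> reflect_poly b dvd 1"
    using irr Factorial_Ring.irreducibleD by blast
  moreover have "a \<noteq> 0" "b \<noteq> 0" using nz by auto
  ultimately show "a dvd 1 \<or> b dvd 1"
    using nz by (simp add: is_unit_iff_degree)
qed

lemma monic_irreducible_dvd_imp_eq:
  fixes h h' :: "'k::field poly"
  assumes "Factorial_Ring.irreducible h" "Factorial_Ring.irreducible h'" "h dvd h'"
    "Polynomial.lead_coeff h = 1" "Polynomial.lead_coeff h' = 1"
  shows "h = h'"
proof -
  obtain c where c: "h' = h * c" using assms(3) by (auto elim: dvdE)
  then have "c dvd 1"
    using assms(1,2) by (meson Factorial_Ring.irreducibleD irreducible_not_unit)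
  then obtain a where a: "c = [:a:]" by (auto elim: is_unit_polyE)
  then have "a = 1"
    using assms(4,5) unfolding c by (simp only: lead_coeff_mult) simp
  then show ?thesis using a c by simp
qed

text \<open>
  Distinct monic irreducible polynomials are pairwise non-associated primes, so divisibility
  accumulates over the product. Indexing by a set of polynomials encodes their distinctness.
\<close>

lemma prod_dvd_iff_monic_irreducible:
  fixes p :: "'k::field poly"
  assumes "finite T"
    and "\<And>h. h \<in> T \<Longrightarrow> Factorial_Ring.irreducible h \<and> Polynomial.lead_coeff h = 1"
  shows "\<Prod>T dvd p \<longleftrightarrow> (\<forall>h\<in>T. h dvd p)"
proof
  assume "\<Prod>T dvd p"
  then show "\<forall>h\<in>T. h dvd p"
    using assms(1) by (meson dvd_prod_eqI dvd_trans dvd_refl)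
next
  show "\<forall>h\<in>T. h dvd p \<Longrightarrow> \<Prod>T dvd p"
    using assms
  proof (induction T rule: finite_induct)
    case (insert h T)
    have h: "prime_elem h" using insert.prems(2) by (auto intro: field_poly_irreducible_imp_prime)
    have "\<Prod>T dvd p" using insert by auto
    then obtain w where w: "p = \<Prod>T * w" by (auto elim: dvdE)
    have "\<not> h dvd \<Prod>T"
    proof
      assume "h dvd \<Prod>T"
      then obtain h' where "h' \<in> T" "h dvd h'"
        using prime_elem_dvd_prod_msetE[OF h, of "mset_set T"] insert.hyps(1)
        by (auto simp: prod_unfold_prod_mset)
      then have "h = h'"
        using insert.prems(2) by (intro monic_irreducible_dvd_imp_eq) auto
      then show False using \<open>h' \<in> T\<close> insert.hyps(2) by simp
    qed
    then have "h dvd w"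
      using insert.prems(1) h w by (auto simp: prime_elem_dvd_mult_iff)
    then show ?case using insert.hyps w by (auto simp: mult.commute mult_dvd_mono)
  qed simp
qed

section \<open>The halves of an element and principal left ideals\<close>

text \<open>
  The polynomials \<open>P\<close> (for \<open>e = False\<close>) and \<open>Q\<close> (for \<open>e = True\<close>) of \<open>u = P(a) + b Q(a)\<close>. Making the
  choice an argument lets every statement treat both at once.
\<close>

definition half_part :: "nat \<Rightarrow> bool \<Rightarrow> (bool \<times> nat \<Rightarrow> 'k::field) \<Rightarrow> 'k poly" where
  "half_part n e u = (\<Sum>i<n. Polynomial.monom (u (e, i)) i)"

lemma P_part_eq_half_part: "n > 0 \<Longrightarrow> P_part n u = half_part n False u"
  by (simp add: P_part_def half_part_def dih_a_pow)

lemma Q_part_eq_half_part: "n > 0 \<Longrightarrow> Q_part n u = half_part n True u"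
  by (simp add: Q_part_def half_part_def dih_a_pow dih_b_mult)

lemma coeff_half_part: "poly.coeff (half_part n e u) i = (if i < n then u (e, i) else 0)"
  by (simp add: half_part_def poly_coeff_sum_monom)

lemma degree_half_part: "n > 0 \<Longrightarrow> Polynomial.degree (half_part n e u) < n"
  using degree_le[of "n - 1" "half_part n e u"] by (fastforce simp: coeff_half_part)

lemma half_part_zero [simp]: "half_part n e (\<lambda>_. 0) = 0"
  by (simp add: half_part_def)

lemma half_part_inject:
  assumes "u \<in> carrier (dihedral_algebra n)" "v \<in> carrier (dihedral_algebra n)"
    and "\<And>e. half_part n e u = half_part n e v"
  shows "u = v"
proof (rule ext, clarify)
  fix e i
  show "u (e, i) = v (e, i)"
    using assms(1,2) arg_cong[OF assms(3)[of e], of "\<lambda>p. poly.coeff p i"]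
    by (cases "i < n") (auto simp: coeff_half_part group_algebra_def dihedral_group_def)
qed

text \<open>
  Reduction modulo \<open>x\<^sup>n - 1\<close> is reduction of exponents modulo \<open>n\<close>; this links the group
  algebra, where \<open>a\<^sup>n = 1\<close>, to congruences of polynomials.
\<close>

lemma xn_minus_1_dvd_monom_mod:
  "Polynomial.monom 1 n - 1 dvd Polynomial.monom c (m mod n) - Polynomial.monom (c::'k::field) m"
proof -
  have "Polynomial.monom c m = Polynomial.monom c (m mod n) * Polynomial.monom 1 n ^ (m div n)"
    by (simp add: monom_power mult_monom)
  then have "Polynomial.monom c (m mod n) - Polynomial.monom c m =
      - Polynomial.monom c (m mod n) * (Polynomial.monom 1 n ^ (m div n) - 1)"
    by (simp add: algebra_simps)
  moreover have "Polynomial.monom 1 n - 1 dvd (Polynomial.monom (1::'k) n ^ (m div n) - 1)"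
    by (simp add: power_diff_1_eq)
  ultimately show ?thesis by (metis dvd_mult)
qed

lemma degree_xn_minus_1:
  "n > 0 \<Longrightarrow> Polynomial.degree (Polynomial.monom 1 n - 1 :: 'k::field poly) = n"
  by (intro antisym degree_le le_degree) (auto simp: coeff_1)

lemma xn_minus_1_dvd_imp_eq:
  fixes p q :: "'k::field poly"
  assumes "n > 0" "Polynomial.degree p < n" "Polynomial.degree q < n"
    and "Polynomial.monom 1 n - 1 dvd p - q"
  shows "p = q"
proof (rule ccontr)
  assume "p \<noteq> q"
  then have "n \<le> Polynomial.degree (p - q)"
    using dvd_imp_degree_le[OF assms(4)] by (simp add: degree_xn_minus_1[OF assms(1)])
  then show False
    using degree_diff_less[OF assms(2,3)] by simp
qed

text \<open>
  Right multiplication by \<open>a\<^sup>k\<close> sends \<open>b\<^sup>e a\<^sup>j\<close> to \<open>b\<^sup>e a\<^bsup>j + k\<^esup>\<close>, so it leaves \<open>e\<close> alone and the two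
  halves of \<open>u\<close> are convolved with the coefficients of \<open>p\<close> independently.
\<close>

lemma mult_ga_eval_dih_a:
  fixes u :: "bool \<times> nat \<Rightarrow> 'k::field"
  assumes "n > 0" "i < n"
  shows "(u \<otimes>\<^bsub>dihedral_algebra n\<^esub> ga_eval (dihedral_group n) p (dih_a n)) (e, i) =
    (\<Sum>j<n. \<Sum>k\<le>Polynomial.degree p. if (j + k) mod n = i then u (e, j) * poly.coeff p k else 0)"
proof -
  interpret group "dihedral_group n" by (rule group_dihedral_group[OF assms(1)])
  let ?D = "dihedral_group n"
  have carr: "carrier ?D = UNIV \<times> {..<n}" by (simp add: dihedral_group_def)
  have eval: "ga_eval ?D p (dih_a n) (inv\<^bsub>?D\<^esub> (e', j) \<otimes>\<^bsub>?D\<^esub> (e, i)) =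
      (\<Sum>k\<le>Polynomial.degree p. if e = e' \<and> (j + k) mod n = i then poly.coeff p k else 0)"
    if j: "j < n" for e' j
  proof -
    have iff: "inv\<^bsub>?D\<^esub> (e', j) \<otimes>\<^bsub>?D\<^esub> (e, i) = (False, k mod n) \<longleftrightarrow> e = e' \<and> (j + k) mod n = i" for k
    proof -
      have "inv\<^bsub>?D\<^esub> (e', j) \<otimes>\<^bsub>?D\<^esub> (e, i) = (False, k mod n) \<longleftrightarrow>
          (e, i) = (e', j) \<otimes>\<^bsub>?D\<^esub> (False, k mod n)"
        using j assms inv_solve_left[of "(False, k mod n)" "(e', j)" "(e, i)"]
        by (auto simp: carr)
      then show ?thesis by (auto simp: dihedral_group_def mod_simps)
    qed
    show ?thesis
      unfolding ga_eval_def ga_single_def dih_a_pow[OF assms(1)] iff ..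
  qed
  have "(u \<otimes>\<^bsub>dihedral_algebra n\<^esub> ga_eval ?D p (dih_a n)) (e, i) =
      (\<Sum>y\<in>UNIV \<times> {..<n}. u y * ga_eval ?D p (dih_a n) (inv\<^bsub>?D\<^esub> y \<otimes>\<^bsub>?D\<^esub> (e, i)))"
    using assms by (simp add: group_algebra_def carr)
  also have "\<dots> = (\<Sum>e'\<in>UNIV. \<Sum>j<n. u (e', j) *
      (\<Sum>k\<le>Polynomial.degree p. if e = e' \<and> (j + k) mod n = i then poly.coeff p k else 0))"
    unfolding sum.cartesian_product by (intro sum.cong) (auto simp: eval)
  also have "\<dots> = (\<Sum>j<n. u (e, j) *
      (\<Sum>k\<le>Polynomial.degree p. if (j + k) mod n = i then poly.coeff p k else 0))"
    by (cases e) (simp_all add: UNIV_bool)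
  finally show ?thesis by (simp add: sum_distrib_left if_distrib cong: if_cong)
qed

text \<open>
  In other words \<open>(P(a) + b Q(a)) p(a) = (P p)(a) + b (Q p)(a)\<close>, read modulo \<open>x\<^sup>n - 1\<close>.
\<close>

lemma half_part_mult_ga_eval:
  fixes u :: "bool \<times> nat \<Rightarrow> 'k::field"
  assumes "n > 0"
  shows "Polynomial.monom 1 n - 1 dvd
    half_part n e (u \<otimes>\<^bsub>dihedral_algebra n\<^esub> ga_eval (dihedral_group n) p (dih_a n)) -
    half_part n e u * p"
proof -
  let ?c = "\<lambda>j k. u (e, j) * poly.coeff p k"
  have 1: "half_part n e (u \<otimes>\<^bsub>dihedral_algebra n\<^esub> ga_eval (dihedral_group n) p (dih_a n)) =
      (\<Sum>j<n. \<Sum>k\<le>Polynomial.degree p. Polynomial.monom (?c j k) ((j + k) mod n))"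
  proof (rule poly_eqI)
    fix i
    have "\<not> i < n \<Longrightarrow> (j + k) mod n \<noteq> i" for j k using assms by auto
    then show "poly.coeff (half_part n e
          (u \<otimes>\<^bsub>dihedral_algebra n\<^esub> ga_eval (dihedral_group n) p (dih_a n))) i =
        poly.coeff (\<Sum>j<n. \<Sum>k\<le>Polynomial.degree p. Polynomial.monom (?c j k) ((j + k) mod n)) i"
      by (cases "i < n") (simp_all add: coeff_half_part mult_ga_eval_dih_a[OF assms] coeff_sum)
  qed
  have "half_part n e u * p = half_part n e u * (\<Sum>k\<le>Polynomial.degree p. Polynomial.monom (poly.coeff p k) k)"
    by (simp add: poly_as_sum_of_monoms)
  also have "\<dots> = (\<Sum>j<n. \<Sum>k\<le>Polynomial.degree p. Polynomial.monom (?c j k) (j + k))"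
    unfolding half_part_def by (simp add: sum_product mult_monom)
  finally show ?thesis
    unfolding 1 by (simp add: sum_subtractf[symmetric] dvd_sum xn_minus_1_dvd_monom_mod)
qed

text \<open>
  Divisibility by a divisor \<open>F\<close> of \<open>x\<^sup>n - 1\<close> survives reduction modulo \<open>x\<^sup>n - 1\<close>, which gives
  one inclusion. Conversely the quotients of the two halves by \<open>F\<close> have degree less than \<open>n\<close> and
  are therefore the two halves of a cofactor in the group algebra.
\<close>

lemma principal_left_ideal_ga_eval:
  fixes F :: "'k::field poly"
  assumes n: "n > 0" and F: "F dvd Polynomial.monom 1 n - 1"
  shows "principal_left_ideal (dihedral_algebra n) (ga_eval (dihedral_group n) F (dih_a n)) =
    {u \<in> carrier (dihedral_algebra n). \<forall>e. F dvd half_part n e u}"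
proof (intro equalityI subsetI)
  fix v assume "v \<in> principal_left_ideal (dihedral_algebra n) (ga_eval (dihedral_group n) F (dih_a n))"
  then obtain u where v: "v = u \<otimes>\<^bsub>dihedral_algebra n\<^esub> ga_eval (dihedral_group n) F (dih_a n)"
    by (auto simp: principal_left_ideal_def)
  have "F dvd half_part n e v - half_part n e u * F" for e
    unfolding v using F half_part_mult_ga_eval[OF n] dvd_trans by blast
  then have "F dvd half_part n e v" for e
    using dvd_add[OF _ dvd_triv_right, of F "half_part n e v - half_part n e u * F" "half_part n e u"]
    by simp
  then show "v \<in> {u \<in> carrier (dihedral_algebra n). \<forall>e. F dvd half_part n e u}"
    by (simp add: v group_algebra_def)
next
  fix v assume v: "v \<in> {u \<in> carrier (dihedral_algebra n). \<forall>e. F dvd half_part n e u}"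
  define p where "p = (\<lambda>e. half_part n e v div F)"
  have p: "half_part n e v = p e * F" for e
    using v by (simp add: p_def)
  have deg: "Polynomial.degree (p e) < n" for e
  proof (cases "p e = 0")
    case False
    have "F \<noteq> 0"
      using F degree_xn_minus_1[OF n, where 'k = 'k] n by (metis dvd_0_left degree_0 less_irrefl)
    then have "Polynomial.degree (p e) \<le> Polynomial.degree (p e * F)"
      using False by (simp add: degree_mult_eq)
    then show ?thesis using degree_half_part[OF n, of e v] p[of e] by simp
  qed (use n in simp)
  define u where "u = (\<lambda>(e, i). poly.coeff (p e) i)"
  have u: "u \<in> carrier (dihedral_algebra n)"
    using deg by (auto simp: u_def group_algebra_def dihedral_group_def not_less intro!: coeff_eq_0 intro: less_le_trans)
  have up: "half_part n e u = p e" for e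
    using deg[of e] by (intro poly_eqI) (auto simp: coeff_half_part u_def coeff_eq_0)
  let ?w = "u \<otimes>\<^bsub>dihedral_algebra n\<^esub> ga_eval (dihedral_group n) F (dih_a n)"
  have "half_part n e ?w = half_part n e v" for e
    using half_part_mult_ga_eval[OF n, of e u F]
    by (intro xn_minus_1_dvd_imp_eq[OF n] degree_half_part[OF n]) (simp add: p up)
  then have "v = ?w"
    using v by (intro half_part_inject[of _ n]) (auto simp: group_algebra_def)
  then show "v \<in> principal_left_ideal (dihedral_algebra n) (ga_eval (dihedral_group n) F (dih_a n))"
    using u by (auto simp: principal_left_ideal_def)
qed

section \<open>The matrix components\<close>

lemma mat2_nth [simp]:
  "mat2 a b c d $ 1 $ 1 = a" "mat2 a b c d $ 1 $ 2 = b"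
  "mat2 a b c d $ 2 $ 1 = c" "mat2 a b c d $ 2 $ 2 = d"
  by (simp_all add: mat2_def)

lemma mat2_eq_iff [simp]:
  "mat2 a b c d = mat2 a' b' c' d' \<longleftrightarrow> a = a' \<and> b = b' \<and> c = c' \<and> d = d'"
  by (auto simp: vec_eq_iff forall_2)

lemma mat2_mult:
  "mat2 a b c d ** mat2 a' b' c' d' =
     mat2 (a * a' + b * c') (a * b' + b * d') (c * a' + d * c') (c * b' + d * (d' :: 'a::comm_ring_1))"
  by (simp add: vec_eq_iff forall_2 matrix_matrix_mult_def sum_2)

lemma mat2_one: "mat 1 = (mat2 1 0 0 1 :: 'a::comm_ring_1^2^2)"
  by (simp add: vec_eq_iff forall_2 mat_def)

lemma mat2_zero: "0 = (mat2 0 0 0 0 :: 'a::comm_ring_1^2^2)"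
  by (simp add: vec_eq_iff forall_2)

lemma mat2_in_matrices_over:
  "mat2 a b c d \<in> matrices_over K \<longleftrightarrow> a \<in> K \<and> b \<in> K \<and> c \<in> K \<and> d \<in> K"
  by (auto simp: matrices_over_def forall_2)

lemma matrix_inv_unique:
  fixes A B :: "'a::comm_ring_1^2^2"
  assumes "A ** B = mat 1" "B ** A = mat 1"
  shows "matrix_inv A = B"
proof -
  have "A ** matrix_inv A = mat 1 \<and> matrix_inv A ** A = mat 1"
    unfolding matrix_inv_def
    by (rule someI[of "\<lambda>A'. A ** A' = mat 1 \<and> A' ** A = mat 1" B]) (use assms in simp)
  then have inv: "A ** matrix_inv A = mat 1" ..
  have "matrix_inv A = B ** A ** matrix_inv A"
    by (simp only: assms(2) matrix_mul_lid)
  also have "\<dots> = B ** (A ** matrix_inv A)"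
    by (rule matrix_mul_assoc[symmetric])
  finally show ?thesis
    unfolding inv by (simp only: matrix_mul_rid)
qed

lemma Z_mat_inverse:
  assumes "\<beta> \<noteq> 0" "\<beta> \<noteq> inverse \<beta>"
  defines "d \<equiv> \<beta> - inverse \<beta>"
  shows "matrix_inv (Z_mat \<beta>) = mat2 (- inverse \<beta> / d) (\<beta> / d) (- 1 / d) (1 / d)" (is "_ = ?W")
    and "Z_mat \<beta> ** matrix_inv (Z_mat \<beta>) = mat 1"
proof -
  have d: "d \<noteq> 0" using assms by simp
  have 1: "Z_mat \<beta> ** ?W = mat 1" "?W ** Z_mat \<beta> = mat 1"
    using assms(1) d unfolding Z_mat_def mat2_mult mat2_one
    by (simp_all add: divide_simps) (simp_all add: d_def right_diff_distrib left_diff_distrib)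
  show 2: "matrix_inv (Z_mat \<beta>) = ?W" by (rule matrix_inv_unique[OF 1])
  show "Z_mat \<beta> ** matrix_inv (Z_mat \<beta>) = mat 1"
    unfolding 2 by (fact 1)
qed

lemma inj_sigma_map:
  assumes "\<beta> \<noteq> 0" "\<beta> \<noteq> inverse \<beta>"
  shows "inj (sigma_map \<beta>)"
proof (rule injI)
  note Z = Z_mat_inverse(2)[OF assms]
  have *: "Z_mat \<beta> ** sigma_map \<beta> M ** matrix_inv (Z_mat \<beta>) = M" for M
  proof -
    have "Z_mat \<beta> ** sigma_map \<beta> M ** matrix_inv (Z_mat \<beta>) =
        (Z_mat \<beta> ** matrix_inv (Z_mat \<beta>)) ** M ** (Z_mat \<beta> ** matrix_inv (Z_mat \<beta>))"
      unfolding sigma_map_def by (simp only: matrix_mul_assoc)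
    then show ?thesis by (simp only: Z matrix_mul_lid matrix_mul_rid)
  qed
  fix M N assume "sigma_map \<beta> M = sigma_map \<beta> N"
  then have "Z_mat \<beta> ** sigma_map \<beta> M ** matrix_inv (Z_mat \<beta>) =
      Z_mat \<beta> ** sigma_map \<beta> N ** matrix_inv (Z_mat \<beta>)" by (rule arg_cong)
  then show "M = N" unfolding * .
qed

text \<open>
  The entries are grouped so that, for the matrices \<open>tau_map n \<beta> u\<close>, each quotient is a
  difference of a value at \<open>\<beta>\<close> and the corresponding value at \<open>inverse \<beta>\<close>, divided by
  \<open>\<beta> - inverse \<beta>\<close> (up to a swap in the first entry).
\<close>

lemma sigma_map_mat2:
  assumes "\<beta> \<noteq> 0" "\<beta> \<noteq> inverse \<beta>"
  defines "d \<equiv> \<beta> - inverse \<beta>"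
  shows "sigma_map \<beta> (mat2 p q' q p') =
    mat2 ((\<beta> * q - inverse \<beta> * q') / d + (\<beta> * p' - inverse \<beta> * p) / d)
         ((p - p') / d - (\<beta> * (\<beta> * q) - inverse \<beta> * (inverse \<beta> * q')) / d)
         ((q - q') / d - (p - p') / d)
         ((\<beta> * p - inverse \<beta> * p') / d - (\<beta> * q - inverse \<beta> * q') / d)"
proof -
  \<comment> \<open>With \<open>i\<close> for \<open>inverse \<beta>\<close> and \<open>e\<close> for \<open>inverse d\<close> this is a polynomial identity modulo \<open>b * i = 1\<close>.\<close>
  have "mat2 (- i * e) (b * e) (- 1 * e) (1 * e) ** mat2 p q' q p' ** mat2 1 (- b) 1 (- i) =
      mat2 ((b * q - i * q') * e + (b * p' - i * p) * e)
           ((p - p') * e - (b * (b * q) - i * (i * q')) * e)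
           ((q - q') * e - (p - p') * e)
           ((b * p - i * p') * e - (b * q - i * q') * e)"
    if "b * i = 1" for b i e
  proof -
    have "(- i * e * p + b * e * q) * - b + (- i * e * q' + b * e * p') * - i =
        (b * i) * ((p - p') * e) - (b * (b * q) - i * (i * q')) * e"
      by (simp add: algebra_simps)
    then show ?thesis
      unfolding mat2_mult mat2_eq_iff that mult_1_left
      by (intro conjI) (assumption | simp add: algebra_simps)+
  qed
  from this[OF right_inverse[OF assms(1)], of "inverse d"] show ?thesis
    unfolding sigma_map_def Z_mat_inverse(1)[OF assms(1,2), folded d_def]
    unfolding Z_mat_def divide_inverse .
qed

lemma to_ac_in_adjoin: "to_ac c \<in> adjoin \<beta>"
  unfolding adjoin_def by (rule range_eqI[of _ _ "[:c:]"]) simp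

lemma generator_in_adjoin: "\<beta> \<in> adjoin \<beta>"
  unfolding adjoin_def by (rule range_eqI[of _ _ "[:0, 1:]"]) simp

lemma adjoin_add: "x \<in> adjoin \<beta> \<Longrightarrow> y \<in> adjoin \<beta> \<Longrightarrow> x + y \<in> adjoin \<beta>"
  by (auto simp: adjoin_def simp flip: poly_add ac_poly_add)

lemma adjoin_diff: "x \<in> adjoin \<beta> \<Longrightarrow> y \<in> adjoin \<beta> \<Longrightarrow> x - y \<in> adjoin \<beta>"
  by (auto simp: adjoin_def simp flip: poly_diff ac_poly_diff)

lemma adjoin_mult: "x \<in> adjoin \<beta> \<Longrightarrow> y \<in> adjoin \<beta> \<Longrightarrow> x * y \<in> adjoin \<beta>"
  by (auto simp: adjoin_def simp flip: poly_mult ac_poly_mult)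

lemma poly_in_adjoin:
  assumes "x \<in> adjoin \<beta>"
  shows "poly (ac_poly p) x \<in> adjoin \<beta>"
proof (induction p)
  case 0
  show ?case using to_ac_in_adjoin[of 0 \<beta>] by simp
next
  case (pCons a p)
  then show ?case using assms by (simp add: adjoin_add adjoin_mult to_ac_in_adjoin)
qed

lemma inverse_root_of_unity_in_adjoin:
  assumes "n > 0" "\<beta> ^ n = 1"
  shows "inverse \<beta> \<in> adjoin \<beta>"
proof -
  have "inverse \<beta> = \<beta> ^ (n - 1)"
    using assms power_minus_mult[of n \<beta>] by (intro inverse_unique) (simp add: mult.commute)
  then show ?thesis
    unfolding adjoin_def by (intro range_eqI[of _ _ "Polynomial.monom 1 (n - 1)"]) (simp add: poly_monom)
qed

text \<open>
  Write \<open>D(p) = (p(\<beta>) - p(\<beta>\<^sup>-\<^sup>1)) / (\<beta> - \<beta>\<^sup>-\<^sup>1)\<close>. The two claims concern \<open>D(p)\<close> and \<open>D(x p)\<close>; they are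
  proved together because of the Chebyshev-type recurrence
  \<open>D(x\<^sup>2 p) = (\<beta> + \<beta>\<^sup>-\<^sup>1) D(x p) - D(p)\<close>.
\<close>

lemma antisymmetric_quotient_in_adjoin:
  fixes \<beta> :: "'a::field alg_closure"
  assumes "\<beta> \<noteq> 0" "\<beta> \<noteq> inverse \<beta>"
  shows "(poly (ac_poly p) \<beta> - poly (ac_poly p) (inverse \<beta>)) / (\<beta> - inverse \<beta>)
            \<in> adjoin (\<beta> + inverse \<beta>)" (is "?D p \<in> ?K")
    and "(\<beta> * poly (ac_poly p) \<beta> - inverse \<beta> * poly (ac_poly p) (inverse \<beta>)) / (\<beta> - inverse \<beta>)
            \<in> adjoin (\<beta> + inverse \<beta>)" (is "?E p \<in> ?K")
proof -
  have d: "\<beta> - inverse \<beta> \<noteq> 0" using assms by simp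
  have c: "\<beta> * inverse \<beta> = 1" using assms(1) by simp
  have "?D p \<in> ?K \<and> ?E p \<in> ?K"
  proof (induction p)
    case 0
    show ?case using to_ac_in_adjoin[of 0] by simp
  next
    case (pCons a p)
    have 1: "?D (pCons a p) = ?E p" by simp
    let ?x = "poly (ac_poly p) \<beta>" and ?y = "poly (ac_poly p) (inverse \<beta>)"
    \<comment> \<open>The recurrence plus the contribution of the constant term, again with \<open>b\<close> and \<open>i\<close> for \<open>\<beta>\<close> and its inverse.\<close>
    have "(b * (z + b * x) - i * (z + i * y)) / e = z + (b + i) * ((b * x - i * y) / e) - (x - y) / e"
      if "b * i = 1" "e = b - i" "e \<noteq> 0" for b i e x y z :: "'a alg_closure"
    proof -
      have "(b + i) * (b * x - i * y) = b * (b * x) - (b * i) * y + (b * i) * x - i * (i * y)"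
        by (simp add: algebra_simps)
      also have "\<dots> = b * (b * x) - y + x - i * (i * y)"
        by (simp add: that(1))
      finally have "e * z + (b + i) * (b * x - i * y) - (x - y) =
          e * z + (b * (b * x) - y + x - i * (i * y)) - (x - y)"
        by (rule arg_cong)
      also have "\<dots> = b * (z + b * x) - i * (z + i * y)"
        unfolding that(2) by (simp add: algebra_simps)
      finally have "b * (z + b * x) - i * (z + i * y) = e * z + (b + i) * (b * x - i * y) - (x - y)"
        by (rule sym)
      then show ?thesis
        using \<open>e \<noteq> 0\<close> by (simp only: diff_divide_distrib[of "_ + _"] add_divide_distrib times_divide_eq_right) simp
    qed
    from this[OF c refl d] have 2: "?E (pCons a p) = to_ac a + (\<beta> + inverse \<beta>) * ?E p - ?D p"
      by (simp only: ac_poly_pCons poly_pCons)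
    show ?case
      unfolding 1 2 using pCons.IH
      by (intro conjI generator_in_adjoin to_ac_in_adjoin adjoin_add adjoin_diff adjoin_mult) auto
  qed
  then show "?D p \<in> ?K" "?E p \<in> ?K" by auto
qed

text \<open>
  Conjugation by \<open>Z_mat \<beta>\<close> brings the image of the group algebra down from the field of \<open>\<beta>\<close> to
  the subfield of \<open>\<beta> + \<beta>\<^sup>-\<^sup>1\<close>: every entry is a combination of the quotients of
  \<open>antisymmetric_quotient_in_adjoin\<close>.
\<close>

lemma sigma_tau_in_matrices_over:
  assumes "\<beta> \<noteq> 0" "\<beta> \<noteq> inverse \<beta>"
  shows "sigma_map \<beta> (tau_map n \<beta> u) \<in> matrices_over (adjoin (\<beta> + inverse \<beta>))"
proof -
  let ?K = "adjoin (\<beta> + inverse \<beta>)" and ?d = "\<beta> - inverse \<beta>"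
  let ?D = "\<lambda>p. (poly (ac_poly p) \<beta> - poly (ac_poly p) (inverse \<beta>)) / ?d"
  let ?E = "\<lambda>p. (\<beta> * poly (ac_poly p) \<beta> - inverse \<beta> * poly (ac_poly p) (inverse \<beta>)) / ?d"
  let ?P = "P_part n u" and ?Q = "Q_part n u"
  note in_K = antisymmetric_quotient_in_adjoin[OF assms] generator_in_adjoin
    adjoin_add adjoin_diff adjoin_mult
  let ?x' = "\<beta> * poly (ac_poly ?P) \<beta> - inverse \<beta> * poly (ac_poly ?P) (inverse \<beta>)"
  let ?y' = "\<beta> * poly (ac_poly ?P) (inverse \<beta>) - inverse \<beta> * poly (ac_poly ?P) \<beta>"
  have 1: "?y' / ?d =
      ?E ?P - (\<beta> + inverse \<beta>) * ?D ?P"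
  proof -
    have "?y' = ?x' - (\<beta> + inverse \<beta>) * (poly (ac_poly ?P) \<beta> - poly (ac_poly ?P) (inverse \<beta>))"
      by (simp add: algebra_simps)
    then show ?thesis by (simp only: diff_divide_distrib[symmetric] times_divide_eq_right)
  qed
  have 2: "(\<beta> * (\<beta> * poly (ac_poly ?Q) \<beta>) - inverse \<beta> * (inverse \<beta> * poly (ac_poly ?Q) (inverse \<beta>))) / ?d
      \<in> ?K"
    using in_K(2)[of "pCons 0 ?Q"] by simp
  show ?thesis
    unfolding tau_map_def sigma_map_mat2[OF assms] mat2_in_matrices_over 1
    by (intro conjI 2 in_K)
qed

section \<open>The factors of \<open>x\<^sup>n - 1\<close>\<close>

lemma xn_factors:
  assumes "xn_factorization n r s f"
  shows "j \<in> {1..r+s} \<Longrightarrow> Factorial_Ring.irreducible (f j)"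
    and "j \<in> {1..r+s} \<Longrightarrow> Polynomial.lead_coeff (f j) = 1"
    and "j \<in> {1..r+s} \<Longrightarrow> f j dvd Polynomial.monom 1 n - 1"
    and "Polynomial.monom 1 n - 1 = (\<Prod>j\<in>{1..r+s}. f j) * (\<Prod>j\<in>{r+1..r+s}. monic_reciprocal (f j))"
proof -
  show "j \<in> {1..r+s} \<Longrightarrow> Factorial_Ring.irreducible (f j)"
    and "j \<in> {1..r+s} \<Longrightarrow> Polynomial.lead_coeff (f j) = 1"
    using assms by (auto simp: xn_factorization_def)
  have "{1..r+s} = {1..r} \<union> {r+1..r+s}" by auto
  then have "(\<Prod>j\<in>{1..r+s}. f j) = (\<Prod>j\<in>{1..r}. f j) * (\<Prod>j\<in>{r+1..r+s}. f j)"
    by (simp only: prod.union_disjoint[of "{1..r}" "{r+1..r+s}"]) (auto intro: prod.union_disjoint)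
  then show "Polynomial.monom 1 n - 1 =
      (\<Prod>j\<in>{1..r+s}. f j) * (\<Prod>j\<in>{r+1..r+s}. monic_reciprocal (f j))"
    using assms unfolding xn_factorization_def by (simp only: prod.distrib mult.assoc)
  then show "j \<in> {1..r+s} \<Longrightarrow> f j dvd Polynomial.monom 1 n - 1"
    by (simp add: dvd_prod_eqI dvd_mult2)
qed

lemma coeff_0_neq_0_if_dvd_xn_minus_1:
  fixes h :: "'k::field poly"
  assumes "n > 0" "h dvd Polynomial.monom 1 n - 1"
  shows "poly.coeff h 0 \<noteq> 0"
proof -
  obtain w where w: "Polynomial.monom 1 n - 1 = h * w" using assms(2) by (auto elim: dvdE)
  have "poly (Polynomial.monom 1 n - 1 :: 'k poly) 0 = - 1"
    using assms(1) by (simp add: poly_monom)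
  then show ?thesis unfolding w by (auto simp: poly_0_coeff_0 coeff_mult_0)
qed

lemma root_dvd_xn_minus_1:
  assumes "n > 0" "h dvd Polynomial.monom 1 n - 1" "poly (ac_poly h) \<beta> = 0"
  shows "\<beta> ^ n = 1" "\<beta> \<noteq> 0"
proof -
  show "\<beta> ^ n = 1"
    using ac_poly_dvd_root[OF assms(2,3)] by (simp add: poly_monom)
  then show "\<beta> \<noteq> 0" using assms(1) by (auto simp: power_0_left)
qed

lemma irreducible_monic_reciprocal:
  fixes h :: "'k::field poly"
  assumes irr: "Factorial_Ring.irreducible h" and h0: "poly.coeff h 0 \<noteq> 0"
  shows "Factorial_Ring.irreducible (monic_reciprocal h)"
    and "Polynomial.lead_coeff (monic_reciprocal h) = 1"
proof -
  let ?c = "inverse (Polynomial.lead_coeff (reflect_poly h))"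
  have nz: "reflect_poly h \<noteq> 0" using h0 by auto
  then show "Polynomial.lead_coeff (monic_reciprocal h) = 1"
    by (simp add: monic_reciprocal_def)
  have "[:?c:] dvd 1" using nz by (simp add: is_unit_const_poly_iff dvd_field_iff)
  then have "Factorial_Ring.irreducible ([:?c:] * reflect_poly h)"
    using irreducible_reflect_poly_field[OF irr h0] irreducible_mult_unit_left by blast
  then show "Factorial_Ring.irreducible (monic_reciprocal h)"
    by (simp add: monic_reciprocal_def)
qed

lemma root_monic_reciprocal:
  assumes "\<beta> \<noteq> 0" "poly (ac_poly h) \<beta> = 0"
  shows "poly (ac_poly (monic_reciprocal h)) (inverse \<beta>) = 0"
  using assms by (simp add: monic_reciprocal_def ac_poly_reflect poly_reflect_poly_nz)

lemma monic_reciprocal_dvd_iff_root: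
  fixes h p :: "'k::field poly"
  assumes "Factorial_Ring.irreducible h" "poly.coeff h 0 \<noteq> 0" "\<beta> \<noteq> 0" "poly (ac_poly h) \<beta> = 0"
  shows "monic_reciprocal h dvd p \<longleftrightarrow> poly (ac_poly p) (inverse \<beta>) = 0"
  using assms by (intro irreducible_dvd_iff_root irreducible_monic_reciprocal root_monic_reciprocal)

text \<open>
  Divisibility by \<open>f\<^sub>j\<close> is a condition at \<open>\<beta>\<close>, divisibility by \<open>f\<^sub>j\<^sup>*\<close> one at \<open>\<beta>\<^sup>-\<^sup>1\<close>: these are the two
  points at which \<open>\<tau>\<^sub>j\<close> evaluates the halves.
\<close>

lemma xn_factor_root:
  assumes "n > 0" "xn_factorization n r s f" "j \<in> {1..r+s}" "poly (ac_poly (f j)) \<beta> = 0"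
  shows "\<beta> ^ n = 1" "\<beta> \<noteq> 0"
    and "f j dvd p \<longleftrightarrow> poly (ac_poly p) \<beta> = 0"
    and "monic_reciprocal (f j) dvd p \<longleftrightarrow> poly (ac_poly p) (inverse \<beta>) = 0"
proof -
  note F = xn_factors(1,3)[OF assms(2,3)]
  show "\<beta> ^ n = 1" and b: "\<beta> \<noteq> 0" using root_dvd_xn_minus_1[OF assms(1) F(2) assms(4)] by auto
  show "f j dvd p \<longleftrightarrow> poly (ac_poly p) \<beta> = 0"
    by (rule irreducible_dvd_iff_root[OF F(1) assms(4)])
  show "monic_reciprocal (f j) dvd p \<longleftrightarrow> poly (ac_poly p) (inverse \<beta>) = 0"
    by (rule monic_reciprocal_dvd_iff_root[OF F(1) coeff_0_neq_0_if_dvd_xn_minus_1[OF assms(1) F(2)] b assms(4)])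
qed

lemma prod_xn_factors_dvd_iff:
  fixes f :: "nat \<Rightarrow> 'k::field poly"
  assumes "n > 0" "xn_factorization n r s f" "J \<subseteq> {1..r+s}" "L \<subseteq> {r+1..r+s}"
  shows "(\<Prod>j\<in>J. f j) * (\<Prod>j\<in>L. monic_reciprocal (f j)) dvd p \<longleftrightarrow>
    (\<forall>j\<in>J. f j dvd p) \<and> (\<forall>j\<in>L. monic_reciprocal (f j) dvd p)"
proof -
  let ?R = "\<lambda>j. monic_reciprocal (f j)"
  have inj: "inj_on f J" "inj_on ?R L" and disj: "f ` J \<inter> ?R ` L = {}"
    using assms(2-4) unfolding xn_factorization_def by (blast intro: inj_on_subset)+
  have fin: "finite J" "finite L" using assms(3,4) by (auto intro: finite_subset)
  have "(\<Prod>j\<in>J. f j) * (\<Prod>j\<in>L. ?R j) = \<Prod>(f ` J) * \<Prod>(?R ` L)"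
    using inj by (simp add: prod.reindex)
  also have "\<dots> = \<Prod>(f ` J \<union> ?R ` L)"
    using fin disj by (simp add: prod.union_disjoint)
  finally have eq: "(\<Prod>j\<in>J. f j) * (\<Prod>j\<in>L. ?R j) = \<Prod>(f ` J \<union> ?R ` L)" .
  have "Factorial_Ring.irreducible h \<and> Polynomial.lead_coeff h = 1" if "h \<in> f ` J \<union> ?R ` L" for h
  proof -
    have "j \<in> {1..r+s}" if "j \<in> J \<union> L" for j using that assms(3,4) by auto
    then show ?thesis
      using that xn_factors(1-3)[OF assms(2)] irreducible_monic_reciprocal coeff_0_neq_0_if_dvd_xn_minus_1[OF assms(1)]
      by blast
  qed
  then show ?thesis
    unfolding eq using fin by (subst prod_dvd_iff_monic_irreducible) auto
qed

text \<open>
  A root with \<open>\<beta>\<^sup>2 = 1\<close> is \<open>1\<close> or \<open>-1\<close>, hence already a root of \<open>f\<^sub>1\<close> or, for even \<open>n\<close>, of \<open>f\<^sub>2\<close>.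
  For odd \<open>n\<close> the equation \<open>\<beta>\<^sup>n = 1\<close> excludes \<open>-1\<close>, unless it coincides with \<open>1\<close>. This is what makes
  \<open>Z_mat \<beta>\<close> invertible.
\<close>

lemma xn_factor_root_neq_inverse:
  fixes f :: "nat \<Rightarrow> 'k::field poly"
  assumes n: "n > 0" and fac: "xn_factorization n r s f" and j: "zeta n < j" "j \<le> r"
    and root: "poly (ac_poly (f j)) \<beta> = 0"
  shows "\<beta> \<noteq> inverse \<beta>"
proof
  assume "\<beta> = inverse \<beta>"
  have j': "j \<in> {1..r+s}" using j by (auto simp: zeta_def split: if_splits)
  note b = xn_factor_root(1,2)[OF n fac j' root]
  have distinct: "poly (ac_poly (f i)) \<beta> \<noteq> 0" if i: "i \<in> {1..r+s}" "i \<noteq> j" for i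
  proof
    assume "poly (ac_poly (f i)) \<beta> = 0"
    then have "f i dvd f j"
      using irreducible_dvd_iff_root[OF xn_factors(1)[OF fac i(1)]] root by blast
    then have "f i = f j"
      using xn_factors(1,2)[OF fac] i(1) j' by (intro monic_irreducible_dvd_imp_eq) auto
    moreover have "inj_on f {1..r+s}" using fac by (simp add: xn_factorization_def)
    ultimately show False using i j' by (meson inj_onD)
  qed
  have "\<beta> * \<beta> = 1" using \<open>\<beta> = inverse \<beta>\<close> b(2) by (metis right_inverse)
  then have "(\<beta> - 1) * (\<beta> + 1) = 0" by (simp add: algebra_simps)
  then have b1: "\<beta> = 1 \<or> \<beta> = - 1" by (simp add: eq_neg_iff_add_eq_0)
  have "f 1 = [:-1, 1:]" "even n \<longrightarrow> f 2 = [:1, 1:]"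
    using fac by (auto simp: xn_factorization_def)
  then have "\<beta> \<noteq> 1" "even n \<Longrightarrow> \<beta> \<noteq> - 1"
    using distinct[of 1] distinct[of 2] j by (auto simp: zeta_def split: if_splits)
  then show False using b1 b(1) by (cases "even n") auto
qed

section \<open>The component maps in terms of divisibility\<close>

lemma gamma_map_eq_iff:
  assumes "n > 0"
  shows "gamma_map n z u = gamma_map n z v \<longleftrightarrow>
    (\<forall>e. poly (half_part n e u) z = poly (half_part n e v) z)"
proof -
  have "gamma_map n z w = (\<lambda>x. if x = 0 then poly (half_part n False w) z
      else if x = 1 then poly (half_part n True w) z else 0)" for w
    using assms
    by (auto simp: gamma_map_def group_algebra_def ga_single_def P_part_eq_half_part Q_part_eq_half_part)
  then show ?thesis
    by (auto simp: fun_eq_iff all_bool_eq dest: spec[of _ 0] spec[of _ 1])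
qed

lemma tau_map_eq_iff:
  assumes "n > 0"
  shows "tau_map n \<beta> u = tau_map n \<beta> v \<longleftrightarrow>
    (\<forall>e. poly (ac_poly (half_part n e u - half_part n e v)) \<beta> = 0 \<and>
         poly (ac_poly (half_part n e u - half_part n e v)) (inverse \<beta>) = 0)"
  using assms by (auto simp: tau_map_def P_part_eq_half_part Q_part_eq_half_part all_bool_eq)

text \<open>
  Each component map sees exactly the residues of the two halves modulo \<open>f\<^sub>j\<close>, and modulo \<open>f\<^sub>j\<^sup>*\<close>
  as well when \<open>j > r\<close>. Taking all \<open>j\<close> together this yields injectivity of the decomposition; with
  \<open>v = 0\<close> it describes the zero component.
\<close>

lemma comp_map_eq_iff:
  fixes f :: "nat \<Rightarrow> 'k::field poly"
  assumes n: "n > 0" and fac: "xn_factorization n r s f" and j: "j \<in> {1..r+s}"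
    and root: "poly (ac_poly (f j)) (\<alpha> j) = 0"
  shows "comp_map n r \<alpha> j u = comp_map n r \<alpha> j v \<longleftrightarrow>
    (\<forall>e. f j dvd half_part n e u - half_part n e v \<and>
         (r < j \<longrightarrow> monic_reciprocal (f j) dvd half_part n e u - half_part n e v))"
proof -
  note R = xn_factor_root[OF n fac j root]
  have f12: "f 1 = [:-1, 1:]" "even n \<longrightarrow> f 2 = [:1, 1:]" "zeta n \<le> r"
    using fac by (auto simp: xn_factorization_def)
  consider (one) "j = 1" | (two) "j = 2" "even n" | (self) "zeta n < j" "j \<le> r" | (pair) "r < j"
    using j by (fastforce simp: zeta_def split: if_splits)
  then show ?thesis
  proof cases
    case one
    have "j \<le> r" using one f12(3) by (auto simp: zeta_def split: if_splits)
    then show ?thesis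
      using one f12(1) poly_eq_0_iff_dvd[of _ "1::'k"]
      by (simp add: comp_map_def gamma_map_eq_iff[OF n] flip: poly_eq_0_iff_dvd)
  next
    case two
    have "j \<le> r" using two f12(3) by (auto simp: zeta_def)
    moreover have "[:1, 1:] dvd p \<longleftrightarrow> poly p (- 1) = 0" for p :: "'k poly"
      using poly_eq_0_iff_dvd[of p "- 1"] by simp
    ultimately show ?thesis
      using two f12(2) by (simp add: comp_map_def zeta_def gamma_map_eq_iff[OF n])
  next
    case self
    have "inverse (\<alpha> j) \<noteq> \<alpha> j"
      using xn_factor_root_neq_inverse[OF n fac self root] by simp
    then have inj: "inj (sigma_map (\<alpha> j))"
      using R(2) by (intro inj_sigma_map) auto
    have "1 < j" using self by (auto simp: zeta_def split: if_splits)
    then have "reflect_poly (f j) = f j" using fac self by (auto simp: xn_factorization_def)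
    then have "monic_reciprocal (f j) = f j"
      using xn_factors(2)[OF fac j] by (simp add: monic_reciprocal_def)
    then have "poly (ac_poly p) (\<alpha> j) = 0 \<longleftrightarrow> poly (ac_poly p) (inverse (\<alpha> j)) = 0" for p
      using R(3,4) by simp
    from this[of "half_part n _ u - half_part n _ v"] show ?thesis
      using self \<open>1 < j\<close> by (simp add: comp_map_def inj_eq[OF inj] tau_map_eq_iff[OF n] R(3))
  next
    case pair
    then have "comp_map n r \<alpha> j w = Inr (tau_map n (\<alpha> j) w)" for w
      using f12(3) by (auto simp: comp_map_def zeta_def split: if_splits)
    then show ?thesis using pair by (simp add: tau_map_eq_iff[OF n] R(3,4))
  qed
qed

lemma comp_map_zero: "n > 0 \<Longrightarrow> 1 \<le> j \<Longrightarrow> comp_map n r \<alpha> j (\<lambda>_. 0) = comp_zero n j"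
proof -
  assume n: "n > 0" and "1 \<le> j"
  have "gamma_map n z (\<lambda>_. 0) = \<zero>\<^bsub>C2_algebra\<^esub>" for z :: 'a
    using n by (auto simp: gamma_map_def group_algebra_def ga_single_def P_part_eq_half_part Q_part_eq_half_part)
  moreover have tau: "tau_map n \<beta> (\<lambda>_. 0) = 0" for \<beta> :: "'a alg_closure"
    using n by (simp add: tau_map_def P_part_eq_half_part Q_part_eq_half_part mat2_zero)
  moreover have "sigma_map \<beta> 0 = 0" for \<beta> :: "'a alg_closure"
    by (simp add: sigma_map_def matrix_matrix_mult_def vec_eq_iff)
  ultimately show ?thesis
    using \<open>1 \<le> j\<close> by (auto simp: comp_map_def comp_zero_def zeta_def)
qed

lemma tau_map_in_matrices_over:
  assumes "n > 0" "\<beta> ^ n = 1"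
  shows "tau_map n \<beta> u \<in> matrices_over (adjoin \<beta>)"
  unfolding tau_map_def mat2_in_matrices_over
  using generator_in_adjoin inverse_root_of_unity_in_adjoin[OF assms]
  by (intro conjI poly_in_adjoin)

lemma comp_map_in_comp_algebra:
  fixes f :: "nat \<Rightarrow> 'k::field poly"
  assumes n: "n > 0" and fac: "xn_factorization n r s f" and j: "j \<in> {1..r+s}"
    and root: "poly (ac_poly (f j)) (\<alpha> j) = 0"
  shows "comp_map n r \<alpha> j u \<in> comp_algebra n r \<alpha> j"
proof -
  have gamma: "gamma_map n z u \<in> carrier C2_algebra" for z
    by (auto simp: gamma_map_def group_algebra_def ga_single_def carrier_integer_mod_group)
  note R = xn_factor_root(1,2)[OF n fac j root]
  have z: "zeta n \<le> r" using fac by (simp add: xn_factorization_def)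
  consider (deg1) "j \<le> zeta n" | (self) "zeta n < j" "j \<le> r" | (pair) "r < j" by linarith
  then show ?thesis
  proof cases
    case deg1
    then show ?thesis using gamma by (auto simp: comp_map_def comp_algebra_def zeta_def)
  next
    case self
    have "j \<noteq> 1" using self by (auto simp: zeta_def split: if_splits)
    then show ?thesis
      using self sigma_tau_in_matrices_over[OF R(2) xn_factor_root_neq_inverse[OF n fac self root]]
      by (simp add: comp_map_def comp_algebra_def comp_field_def)
  next
    case pair
    have "j \<noteq> 1" using pair z by (auto simp: zeta_def split: if_splits)
    then show ?thesis
      using pair z tau_map_in_matrices_over[OF n R(1)]
      by (simp add: comp_map_def comp_algebra_def comp_field_def)
  qed
qed

lemma mat2_in_I_ideal_0_1:
  "mat2 a b c d \<in> I_ideal K 0 1 \<longleftrightarrow> a \<in> K \<and> c \<in> K \<and> b = 0 \<and> d = 0"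
  by (auto simp: I_ideal_def)

lemma mat2_in_I_ideal_1_0:
  "mat2 a b c d \<in> I_ideal (adjoin \<beta>) 1 0 \<longleftrightarrow>
     a = 0 \<and> c = 0 \<and> b \<in> adjoin \<beta> \<and> d \<in> adjoin \<beta>"
proof -
  have "- x \<in> adjoin \<beta> \<longleftrightarrow> x \<in> adjoin \<beta>" for x
    using adjoin_diff[OF to_ac_in_adjoin[of 0]] by force
  moreover have "mat2 a b c d \<in> I_ideal (adjoin \<beta>) 1 0 \<longleftrightarrow>
      a = 0 \<and> c = 0 \<and> - b \<in> adjoin \<beta> \<and> - d \<in> adjoin \<beta>"
    by (auto simp: I_ideal_def) (metis minus_minus)
  ultimately show ?thesis by simp
qed

text \<open>
  The second column of \<open>\<tau>\<^sub>j(u)\<close> holds the values at \<open>\<alpha>\<^sub>j\<^sup>-\<^sup>1\<close>, the first column those at \<open>\<alpha>\<^sub>j\<close>, and the two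
  ideals consist of the matrices whose second, respectively first, column vanishes.
\<close>

lemma comp_map_in_I_ideal:
  fixes f :: "nat \<Rightarrow> 'k::field poly"
  assumes n: "n > 0" and fac: "xn_factorization n r s f" and j: "j \<in> {r+1..r+s}"
    and root: "poly (ac_poly (f j)) (\<alpha> j) = 0"
  shows "comp_map n r \<alpha> j u \<in> Inr ` I_ideal (comp_field n r \<alpha> j) 0 1 \<longleftrightarrow>
      (\<forall>e. monic_reciprocal (f j) dvd half_part n e u)"
    and "comp_map n r \<alpha> j u \<in> Inr ` I_ideal (comp_field n r \<alpha> j) 1 0 \<longleftrightarrow>
      (\<forall>e. f j dvd half_part n e u)"
proof -
  have j': "j \<in> {1..r+s}" using j by auto
  note R = xn_factor_root[OF n fac j' root]
  have "zeta n \<le> r" using fac by (simp add: xn_factorization_def)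
  then have "comp_map n r \<alpha> j u = Inr (tau_map n (\<alpha> j) u)"
    and K: "comp_field n r \<alpha> j = adjoin (\<alpha> j)"
    using j by (auto simp: comp_map_def comp_field_def zeta_def split: if_splits)
  then have in_I: "comp_map n r \<alpha> j u \<in> Inr ` I \<longleftrightarrow> tau_map n (\<alpha> j) u \<in> I" for I
    by auto
  note tau = tau_map_in_matrices_over[OF n R(1), of u, unfolded tau_map_def mat2_in_matrices_over]
  show "comp_map n r \<alpha> j u \<in> Inr ` I_ideal (comp_field n r \<alpha> j) 0 1 \<longleftrightarrow>
      (\<forall>e. monic_reciprocal (f j) dvd half_part n e u)"
    unfolding in_I K tau_map_def mat2_in_I_ideal_0_1 R(4) all_bool_eq
    using tau n by (auto simp: P_part_eq_half_part Q_part_eq_half_part)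
  show "comp_map n r \<alpha> j u \<in> Inr ` I_ideal (comp_field n r \<alpha> j) 1 0 \<longleftrightarrow>
      (\<forall>e. f j dvd half_part n e u)"
    unfolding in_I K tau_map_def mat2_in_I_ideal_1_0 R(3) all_bool_eq
    using tau n by (auto simp: P_part_eq_half_part Q_part_eq_half_part)
qed

section \<open>Dihedral codes generated by a polynomial in the rotation\<close>

theorem theorem9:
  fixes n r s :: nat
    and f :: "nat \<Rightarrow> 'k::{field, finite} poly"
    and \<alpha> :: "nat \<Rightarrow> 'k alg_closure"
    and C :: "(bool \<times> nat \<Rightarrow> 'k) set"
    and K1 K2 K3 :: "nat set"
    and B :: "nat \<Rightarrow> 'k component set"
    and g :: "'k poly"
  assumes "n \<ge> 2"
    and "coprime CARD('k) n"
    and "xn_factorization n r s f"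
    and "\<And>j. j \<in> {1..r+s} \<Longrightarrow> poly (ac_poly (f j)) (\<alpha> j) = 0"
    and "dihedral_code n C"
    and "K1 \<subseteq> {1..r+s}" and "K2 \<subseteq> {r+1..r+s}" and "K3 \<subseteq> {r+1..r+s}"
    and "K1 \<inter> K2 = {}" and "K1 \<inter> K3 = {}" and "K2 \<inter> K3 = {}"
    and "\<And>j. j \<in> {1..r+s} \<Longrightarrow> B j =
           (if j \<in> K1 then comp_algebra n r \<alpha> j
            else if j \<in> K2 then Inr ` I_ideal (comp_field n r \<alpha> j) 0 1
            else if j \<in> K3 then Inr ` I_ideal (comp_field n r \<alpha> j) 1 0
            else {comp_zero n j})"
    and "decomp_map n r s \<alpha> ` C = (\<Pi>\<^sub>E j\<in>{1..r+s}. B j)"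
    and "g = (\<Prod>j\<in>K1 \<union> K2. f j) *
             (\<Prod>j\<in>{r+1..r+s} \<inter> (K1 \<union> K3). monic_reciprocal (f j))"
  shows "C = principal_left_ideal (dihedral_algebra n)
               (ga_eval (dihedral_group n) ((Polynomial.monom 1 n - 1) div g) (dih_a n))"
proof -
  have n: "n > 0" using assms(1) by simp
  note fac = assms(3) and root = assms(4)
  let ?X = "Polynomial.monom 1 n - 1 :: 'k poly"
  let ?R = "\<lambda>j. monic_reciprocal (f j)"
  define J where "J = {1..r+s} - (K1 \<union> K2)"
  define L where "L = {r+1..r+s} - (K1 \<union> K3)"
  define F where "F = (\<Prod>j\<in>J. f j) * (\<Prod>j\<in>L. ?R j)"
  have JL: "J \<subseteq> {1..r+s}" "L \<subseteq> {r+1..r+s}" by (auto simp: J_def L_def)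

  have "(\<Prod>j\<in>{1..r+s}. f j) = (\<Prod>j\<in>J. f j) * (\<Prod>j\<in>K1 \<union> K2. f j)"
    using assms(6,7) unfolding J_def by (intro prod.subset_diff) auto
  moreover have "(\<Prod>j\<in>{r+1..r+s}. ?R j) =
      (\<Prod>j\<in>L. ?R j) * (\<Prod>j\<in>{r+1..r+s} \<inter> (K1 \<union> K3). ?R j)"
  proof -
    have "L = {r+1..r+s} - {r+1..r+s} \<inter> (K1 \<union> K3)" by (auto simp: L_def)
    then show ?thesis by (simp only:) (intro prod.subset_diff; simp)
  qed
  ultimately have X: "?X = F * g"
    using xn_factors(4)[OF fac] assms(14) by (simp add: F_def mult_ac)
  have "?X \<noteq> 0" using degree_xn_minus_1[OF n, where 'k = 'k] n by (metis degree_0 less_irrefl)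
  then have F: "?X div g = F" using X by auto
  have F_dvd: "F dvd p \<longleftrightarrow> (\<forall>j\<in>J. f j dvd p) \<and> (\<forall>j\<in>L. ?R j dvd p)" for p
    unfolding F_def by (rule prod_xn_factors_dvd_iff[OF n fac JL])

  \<comment> \<open>\<open>J\<close> and \<open>L\<close> index the factors \<open>f\<^sub>j\<close> and \<open>f\<^sub>j\<^sup>*\<close> of \<open>F\<close>, so membership in \<open>B j\<close> has to be
    divisibility by those of them that carry the index \<open>j\<close>.\<close>
  have in_B: "comp_map n r \<alpha> j u \<in> B j \<longleftrightarrow>
      (\<forall>e. (j \<in> J \<longrightarrow> f j dvd half_part n e u) \<and> (j \<in> L \<longrightarrow> ?R j dvd half_part n e u))"
    if j: "j \<in> {1..r+s}" for j u
  proof -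
    consider (K1) "j \<in> K1" | (K2) "j \<in> K2" | (K3) "j \<in> K3" | (none) "j \<notin> K1 \<union> K2 \<union> K3" by auto
    then show ?thesis
    proof cases
      case K1
      then show ?thesis
        using comp_map_in_comp_algebra[where \<alpha> = \<alpha>, OF n fac j root[OF j]] assms(12)[OF j] by (simp add: J_def L_def)
    next
      case K2
      then have "j \<in> {r+1..r+s}" "j \<notin> J" "j \<in> L" "j \<notin> K1"
        using assms(7,9,11) by (auto simp: J_def L_def)
      then show ?thesis
        using K2 comp_map_in_I_ideal(1)[where \<alpha> = \<alpha>, OF n fac _ root[OF j]] assms(12)[OF j] by simp
    next
      case K3
      then have "j \<in> {r+1..r+s}" "j \<in> J" "j \<notin> L" "j \<notin> K1" "j \<notin> K2"
        using assms(8,10,11) j by (auto simp: J_def L_def)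
      then show ?thesis
        using K3 comp_map_in_I_ideal(2)[where \<alpha> = \<alpha>, OF n fac _ root[OF j]] assms(12)[OF j] by simp
    next
      case none
      then have "j \<in> J" "j \<in> L \<longleftrightarrow> r < j" using j by (auto simp: J_def L_def)
      moreover have "B j = {comp_map n r \<alpha> j (\<lambda>_. 0)}"
        using none assms(12)[OF j] comp_map_zero[OF n, of j r \<alpha>] j by simp
      ultimately show ?thesis
        using comp_map_eq_iff[where \<alpha> = \<alpha>, OF n fac j root[OF j], of u "\<lambda>_. 0"] by auto
    qed
  qed
  have in_PiE: "decomp_map n r s \<alpha> u \<in> (\<Pi>\<^sub>E j\<in>{1..r+s}. B j) \<longleftrightarrow> (\<forall>e. F dvd half_part n e u)" for u
    using in_B JL unfolding F_dvd decomp_map_def PiE_iff by auto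

  have inj: "u = v" if uv: "u \<in> carrier (dihedral_algebra n)" "v \<in> carrier (dihedral_algebra n)"
    "decomp_map n r s \<alpha> u = decomp_map n r s \<alpha> v" for u v
  proof (rule half_part_inject[OF uv(1,2)])
    fix e
    have "f j dvd half_part n e u - half_part n e v \<and>
        (r < j \<longrightarrow> ?R j dvd half_part n e u - half_part n e v)" if j: "j \<in> {1..r+s}" for j
      using fun_cong[OF uv(3), of j] j comp_map_eq_iff[where \<alpha> = \<alpha>, OF n fac j root[OF j], of u v]
      by (simp add: decomp_map_def)
    then have "?X dvd half_part n e u - half_part n e v"
      unfolding xn_factors(4)[OF fac] prod_xn_factors_dvd_iff[OF n fac order_refl order_refl] by auto
    then show "half_part n e u = half_part n e v"
      by (intro xn_minus_1_dvd_imp_eq[OF n] degree_half_part[OF n])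
  qed

  have C_sub: "C \<subseteq> carrier (dihedral_algebra n)"
    using assms(5) by (simp add: dihedral_code_def left_ideal_def additive_subgroup.a_subset)
  have "C = {u \<in> carrier (dihedral_algebra n). \<forall>e. F dvd half_part n e u}"
  proof (intro equalityI subsetI)
    fix u assume u: "u \<in> C"
    then have "decomp_map n r s \<alpha> u \<in> (\<Pi>\<^sub>E j\<in>{1..r+s}. B j)" using assms(13) by blast
    then show "u \<in> {u \<in> carrier (dihedral_algebra n). \<forall>e. F dvd half_part n e u}"
      using u C_sub in_PiE by blast
  next
    fix u assume u: "u \<in> {u \<in> carrier (dihedral_algebra n). \<forall>e. F dvd half_part n e u}"
    \<comment> \<open>The image of \<open>C\<close> is all of the product of the \<open>B j\<close>, so some element of \<open>C\<close> shares its image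
      with \<open>u\<close>.\<close>
    then have "decomp_map n r s \<alpha> u \<in> decomp_map n r s \<alpha> ` C"
      unfolding assms(13) in_PiE by simp
    then obtain c where c: "c \<in> C" "decomp_map n r s \<alpha> u = decomp_map n r s \<alpha> c" by blast
    then have "u = c" using u C_sub by (intro inj) auto
    then show "u \<in> C" using c(1) by simp
  qed
  then show ?thesis
    unfolding F by (simp add: principal_left_ideal_ga_eval[OF n] X)
qed

end
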